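(* Let $A$ be an expanding $2\times 2$ integer matrix with characteristic polynomial $f(x)=x^2+px+q$ where $|q|\geqslant 3$. Let $\mathcal{D}=\{0,1,\dots,|q|-2,|q|+m\}\mathbf{v}$, where $m\geqslant 0$ is an integer and $\mathbf{v}\in\mathbb{Z}^2$ is such that $\{\mathbf{v},A\mathbf{v}\}$ is linearly independent. Let $T=T(A,\mathcal{D})$ be the self-affine fractal determined by $(A,\mathcal{D})$. Then: (i) when $m\geqslant 1$, $T$ is always disconnected; (ii) when $m=0$, $T$ is connected if and only if $$(p,q)\in \{(p,q)\in\mathbb{Z}^2: 2|p|=|q+2|\}\cup\{(\pm1,-3),(\pm2,3),(\pm3,3),(\pm4,4)\}.$$
   Context: A square matrix is expanding if all its (complex) eigenvalues have modulus strictly larger than $1$. For a set $D\subset\mathbb{Z}$ and a vector $\mathbf{v}$, $D\mathbf{v}=\{d\mathbf{v}: d\in D\}$; thus $\{0,1,\dots,|q|-2,|q|+m\}\mathbf{v}$ has exactly $|q|$ elements. For an expanding integer matrix $A$ and a finite digit set $\mathcal{D}\subset\mathbb{R}^2$, $T(A,\mathcal{D})$ denotes the unique nonempty compact set $T\subset\mathbb{R}^2$ satisfying $AT=T+\mathcal{D}$, equivalently $$T=\left\{\sum_{i=1}^{\infty}A^{-i}\mathbf{d}_i : \mathbf{d}_i\in\mathcal{D}\right\}.$$ *)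

theory Defs
  imports "HOL-Analysis.Analysis" "HOL-Computational_Algebra.Polynomial"
    "HOL-Library.Set_Algebras"
begin

definition charpoly :: "'a::comm_ring_1 ^ 'n ^ 'n \<Rightarrow> 'a poly" where
  "charpoly A = det (mat [:0, 1:] - map_matrix (\<lambda>a. [:a:]) A)"

definition eigenvalue :: "'a::field ^ 'n ^ 'n \<Rightarrow> 'a \<Rightarrow> bool" where
  "eigenvalue A k \<longleftrightarrow> (\<exists>x. x \<noteq> 0 \<and> A *v x = k *s x)"

definition expanding :: "real ^ 'n ^ 'n \<Rightarrow> bool" where
  "expanding A \<longleftrightarrow>
     (\<forall>k :: complex. eigenvalue (map_matrix complex_of_real A) k \<longrightarrow> norm k > 1)"

text \<open>The sum \<open>T + D\<close> is the Minkowski sum. For expanding \<open>A\<close> and finite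
  nonempty \<open>D\<close>, Hutchinson's theorem says that exactly one such \<open>T\<close> exists;
  otherwise the value is meaningless.\<close>

definition self_affine_set :: "real ^ 'n ^ 'n \<Rightarrow> (real ^ 'n) set \<Rightarrow> (real ^ 'n) set" where
  "self_affine_set A D = (THE T. T \<noteq> {} \<and> compact T \<and> (*v) A ` T = T + D)"

definition real_vec :: "int ^ 'n \<Rightarrow> real ^ 'n" where
  "real_vec v = (\<chi> i. real_of_int (v $ i))"

definition real_mat :: "int ^ 'n ^ 'm \<Rightarrow> real ^ 'n ^ 'm" where
  "real_mat A = map_matrix real_of_int A"

definition digit_multiples :: "int set \<Rightarrow> int ^ 'n \<Rightarrow> (real ^ 'n) set" where
  "digit_multiples E v = (\<lambda>d. real_of_int d *\<^sub>R real_vec v) ` E"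

end

(* T is connected iff the graph on the digits with an edge between d and e whenever T + d meets
   T + e is connected. All digits are multiples of v, so an edge between d v and e v means
   (d - e) v \<in> T - T. Since T - T is the attractor of the difference set, which again consists
   of multiples of v, and v, A v span a lattice, such an edge yields a bounded integer sequence
   0, d - e, ... with |x(n+2) + p x(n+1) + q x(n)| <= |q| + m, and conversely when m = 0. The last
   digit |q| + m is at distance at least m + 2 from the others, so T is disconnected unless such a
   sequence starts with 0, l for some l >= m + 2. Bounding the supremum of the sequence by means of
   the characteristic polynomial and comparing with its first few terms leaves only m = 0, l = 2 and
   the listed (p, q); for these there are eventually periodic sequences for both l = 1 and l = 2,
   which connect all the digits. *)

theory Submission
  imports Defs
begin

section \<open>Attractors of expanding linear maps\<close>

text \<open>Topologically, the obstacle is that the inverse \<open>B\<close> of the expanding map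
  need not shrink the Euclidean norm; an equivalent gauge that it does shrink carries boundedness,
  uniqueness and connectedness. Arithmetically, solving the recurrence for its lowest term bounds
  the sequence by its residual bound divided by |q| - |p| - 1. Being expanding forces |p| <= -q - 2
  when q < 0, where this estimate is good enough, but only |p| <= q when q > 0, where the divisor
  may vanish or be negative. For q > 0 and real roots the recurrence is therefore factored into two
  first-order ones; for complex roots, root squaring supplies the missing estimate and finitely many
  pairs remain. Alternating the signs of a sequence replaces p by -p, so only p >= 0 for q < 0 and p
  <= 0 for q > 0 need study. The parameter m drops out of the arithmetic: since l >= m + 2, the
  residual bound |q| + m may be weakened to |q| + l - 2, which leaves only p, q and l.\<close>

locale expanding_map =
  fixes L B :: "'a::euclidean_space \<Rightarrow> 'a"
  assumes linear_L: "linear L" and linear_B: "linear B"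
    and L_B [simp]: "L (B x) = x" and B_L [simp]: "B (L x) = x"
    and iterates_tendsto_0: "(\<lambda>n. (B ^^ n) x) \<longlonglongrightarrow> 0"
begin

lemma linear_iterate: "linear (B ^^ n)"
proof (induction n)
  case 0
  then show ?case by (simp add: linear_id[unfolded id_def])
next
  case (Suc n)
  then show ?case using linear_compose[OF Suc linear_B] by (simp add: o_def)
qed

lemma norm_iterate_le: "norm ((B ^^ n) x) \<le> norm x * (\<Sum>b\<in>Basis. norm ((B ^^ n) b))"
proof -
  interpret l: linear "B ^^ n" by (rule linear_iterate)
  have "(B ^^ n) x = (B ^^ n) (\<Sum>b\<in>Basis. (x \<bullet> b) *\<^sub>R b)"
    by (simp add: euclidean_representation)
  also have "\<dots> = (\<Sum>b\<in>Basis. (x \<bullet> b) *\<^sub>R (B ^^ n) b)"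
    by (simp add: l.sum l.scale)
  finally have "norm ((B ^^ n) x) \<le> (\<Sum>b\<in>Basis. norm ((x \<bullet> b) *\<^sub>R (B ^^ n) b))"
    by (metis norm_sum)
  also have "\<dots> \<le> (\<Sum>b\<in>Basis. norm x * norm ((B ^^ n) b))"
    by (intro sum_mono) (auto intro!: mult_right_mono Basis_le_norm)
  finally show ?thesis by (simp add: sum_distrib_left)
qed

text \<open>Convergence on a basis makes some power \<open>B ^^ N\<close> halve every vector. For
  the sum \<nu> of the norms of the first \<open>N\<close> iterates, passing from \<open>x\<close>
  to \<open>B x\<close> telescopes: \<open>norm x\<close> is replaced by at most
  \<open>norm x / 2\<close>. Since \<nu> is at most \<open>C * norm x\<close>, this loss amounts to
  the factor \<open>1 - 1 / (2*C)\<close>.\<close>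

lemma adapted_norm:
  obtains \<nu> :: "'a \<Rightarrow> real" and \<rho> C :: real
  where "0 \<le> \<rho>" "\<rho> < 1" "\<And>x y. \<nu> (x + y) \<le> \<nu> x + \<nu> y"
    "\<And>x. norm x \<le> \<nu> x" "\<And>x. \<nu> x \<le> C * norm x" "\<And>x. \<nu> (B x) \<le> \<rho> * \<nu> x"
proof -
  have "(\<lambda>n. \<Sum>b\<in>Basis. norm ((B ^^ n) b)) \<longlonglongrightarrow> (\<Sum>b\<in>(Basis::'a set). 0)"
    by (intro tendsto_sum tendsto_norm_zero iterates_tendsto_0)
  then have "(\<lambda>n. \<Sum>b\<in>Basis. norm ((B ^^ n) b)) \<longlonglongrightarrow> 0" by simp
  then have "\<forall>\<^sub>F n in sequentially. (\<Sum>b\<in>Basis. norm ((B ^^ n) b)) < 1/2"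
    by (rule order_tendstoD) simp
  then obtain N where N: "(\<Sum>b\<in>Basis. norm ((B ^^ N) b)) < 1/2"
    by (auto simp: eventually_sequentially)
  define \<nu> where "\<nu> = (\<lambda>x. \<Sum>k<N. norm ((B ^^ k) x))"
  \<comment> \<open>The summand 1 ensures \<open>C \<ge> 1\<close>, so that the contraction factor
    lies in [0, 1).\<close>
  define C where "C = (\<Sum>k<N. \<Sum>b\<in>Basis. norm ((B ^^ k) b)) + 1"
  have C1: "C \<ge> 1" unfolding C_def by (simp add: sum_nonneg)
  have lin: "linear (B ^^ k)" for k by (rule linear_iterate)
  have half: "norm ((B ^^ N) x) \<le> norm x / 2" for x
  proof -
    have "norm ((B ^^ N) x) \<le> norm x * (\<Sum>b\<in>Basis. norm ((B ^^ N) b))" by (rule norm_iterate_le)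
    also have "\<dots> \<le> norm x * (1/2)" using N by (intro mult_left_mono) auto
    finally show ?thesis by simp
  qed
  have N0: "N > 0"
  proof (rule ccontr)
    assume "\<not> N > 0"
    with half[of "SOME b. b \<in> Basis"] have "norm (SOME b::'a. b \<in> Basis) \<le> 0" by simp
    then show False using nonzero_Basis[OF SOME_Basis] by simp
  qed
  have le_\<nu>: "norm x \<le> \<nu> x" for x
  proof -
    have "norm ((B ^^ 0) x) \<le> \<nu> x" unfolding \<nu>_def
      using N0 by (intro member_le_sum) auto
    then show ?thesis by simp
  qed
  have \<nu>_le: "\<nu> x \<le> C * norm x" for x
  proof -
    have "\<nu> x \<le> (\<Sum>k<N. norm x * (\<Sum>b\<in>Basis. norm ((B ^^ k) b)))"
      unfolding \<nu>_def by (intro sum_mono norm_iterate_le)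
    also have "\<dots> = (C - 1) * norm x" by (simp add: C_def sum_distrib_left mult.commute)
    also have "\<dots> \<le> C * norm x" by (intro mult_right_mono) auto
    finally show ?thesis .
  qed
  have contr: "\<nu> (B x) \<le> (1 - 1 / (2*C)) * \<nu> x" for x
  proof -
    have "\<nu> (B x) + norm x = (\<Sum>k<N. norm ((B ^^ Suc k) x)) + norm ((B ^^ 0) x)"
      by (simp add: \<nu>_def funpow_swap1)
    also have "\<dots> = (\<Sum>k<Suc N. norm ((B ^^ k) x))" by (simp add: sum.lessThan_Suc_shift del: sum.lessThan_Suc)
    also have "\<dots> = \<nu> x + norm ((B ^^ N) x)" by (simp add: \<nu>_def)
    finally have "\<nu> (B x) \<le> \<nu> x - norm x / 2" using half[of x] by linarith
    moreover have "\<nu> x / (2*C) \<le> norm x / 2" using \<nu>_le[of x] C1 by (simp add: field_simps)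
    ultimately show ?thesis by (simp add: algebra_simps)
  qed
  show ?thesis
  proof (rule that)
    show "0 \<le> 1 - 1 / (2*C)" "1 - 1 / (2*C) < 1" using C1 by (auto simp: field_simps)
    show "\<nu> (x + y) \<le> \<nu> x + \<nu> y" for x y
      unfolding \<nu>_def sum.distrib[symmetric]
      by (intro sum_mono) (simp add: linear_add[OF lin] norm_triangle_ineq)
  qed (fact le_\<nu> \<nu>_le contr)+
qed

text \<open>Defining the attractor as the largest bounded set in which every point can be continued makes
  the functional equation a formality; compactness and uniqueness come from the adapted norm.\<close>

definition attractor :: "'a set \<Rightarrow> 'a set" where
  "attractor D = \<Union>{X. bounded X \<and> (\<forall>x\<in>X. \<exists>d\<in>D. L x - d \<in> X)}"

text \<open>This is the coinduction rule of the attractor: a bounded set whose points can be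
  continued inside it is a witness of membership.\<close>

lemma subset_attractor:
  assumes "bounded X" "\<And>x. x \<in> X \<Longrightarrow> \<exists>d\<in>D. L x - d \<in> X"
  shows "X \<subseteq> attractor D"
  using assms unfolding attractor_def by (intro Union_upper) simp

lemma attractorE:
  assumes "x \<in> attractor D"
  obtains X where "bounded X" "\<And>x. x \<in> X \<Longrightarrow> \<exists>d\<in>D. L x - d \<in> X" "x \<in> X"
  using assms unfolding attractor_def by auto

lemma attractor_step: "x \<in> attractor D \<Longrightarrow> \<exists>d\<in>D. L x - d \<in> attractor D"
  unfolding attractor_def by blast

text \<open>A witness set remains one when the predecessor \<open>B (t + d)\<close> of one of its
  points is added.\<close>

lemma attractorI:
  assumes "t \<in> attractor D" "d \<in> D"
  shows "B (t + d) \<in> attractor D"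
proof -
  obtain X where X: "bounded X" "\<forall>x\<in>X. \<exists>d\<in>D. L x - d \<in> X" "t \<in> X"
    using assms(1) by (rule attractorE) blast
  have "insert (B (t + d)) X \<subseteq> attractor D"
  proof (rule subset_attractor)
    show "bounded (insert (B (t + d)) X)" using X(1) by simp
    fix x assume "x \<in> insert (B (t + d)) X"
    then show "\<exists>e\<in>D. L x - e \<in> insert (B (t + d)) X"
      using bspec[OF X(2), of x] X(3) assms(2) by (cases "x = B (t + d)") (force intro: bexI[of _ d], blast)
  qed
  then show ?thesis by blast
qed

lemma attractor_eq: "L ` attractor D = attractor D + D"
proof (intro equalityI subsetI)
  fix y assume "y \<in> L ` attractor D"
  then obtain x where x: "x \<in> attractor D" "y = L x" by blast
  from attractor_step[OF x(1)] obtain d where "d \<in> D" "L x - d \<in> attractor D" by blast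
  then have "(L x - d) + d \<in> attractor D + D" by (rule set_plus_intro[rotated])
  then show "y \<in> attractor D + D" using x by simp
next
  fix y assume "y \<in> attractor D + D"
  then obtain t d where "t \<in> attractor D" "d \<in> D" "y = t + d" by (auto elim: set_plus_elim)
  then show "y \<in> L ` attractor D" using attractorI[of t D d] by (auto intro!: image_eqI[of _ _ "B (t + d)"])
qed

text \<open>Each witness set \<open>X\<close> is bounded, but the union needs a bound independent of
  \<open>X\<close>. The supremum \<open>s\<close> of \<nu> over \<open>X\<close> satisfies
  \<open>s \<le> \<rho> * (s + m')\<close>, which bounds \<open>s\<close> in terms of
  \<open>D\<close> alone.\<close>

lemma bounded_attractor:
  assumes "bounded D"
  shows "bounded (attractor D)"
proof -
  obtain \<nu> \<rho> C where \<nu>: "0 \<le> \<rho>" "\<rho> < 1" "\<And>x y. \<nu> (x + y) \<le> \<nu> x + \<nu> y"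
    "\<And>x. norm x \<le> \<nu> x" "\<And>x. \<nu> x \<le> C * norm x" "\<And>x. \<nu> (B x) \<le> \<rho> * \<nu> x"
    using adapted_norm by metis
  obtain m where m: "\<And>d. d \<in> D \<Longrightarrow> norm d \<le> m" using assms by (auto simp: bounded_iff)
  define m' where "m' = max 0 C * m"
  have m': "\<nu> d \<le> m'" if "d \<in> D" for d
  proof -
    have "\<nu> d \<le> C * norm d" by (rule \<nu>)
    also have "\<dots> \<le> max 0 C * norm d" by (intro mult_right_mono) auto
    also have "\<dots> \<le> m'" unfolding m'_def using m[OF that] by (intro mult_left_mono) auto
    finally show ?thesis .
  qed
  have "norm x \<le> \<rho> * m' / (1 - \<rho>)" if x: "x \<in> attractor D" for x
  proof -
    obtain X where X: "bounded X" "\<And>x. x\<in>X \<Longrightarrow> \<exists>d\<in>D. L x - d \<in> X" "x \<in> X"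
      using x by (rule attractorE) blast
    obtain c where c: "\<And>x. x \<in> X \<Longrightarrow> norm x \<le> c" using X(1) by (auto simp: bounded_iff)
    have bdd: "bdd_above (\<nu> ` X)"
    proof (rule bdd_aboveI2)
      fix y assume "y \<in> X"
      have "\<nu> y \<le> C * norm y" by (rule \<nu>)
      also have "\<dots> \<le> max 0 C * norm y" by (intro mult_right_mono) auto
      also have "\<dots> \<le> max 0 C * c" using c[OF \<open>y \<in> X\<close>] by (intro mult_left_mono) auto
      finally show "\<nu> y \<le> max 0 C * c" .
    qed
    define s where "s = (SUP y\<in>X. \<nu> y)"
    have le_s: "\<nu> y \<le> s" if "y \<in> X" for y unfolding s_def using bdd that by (rule cSUP_upper2) simp
    have "s \<le> \<rho> * (s + m')" unfolding s_def
    proof (rule cSUP_least)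
      show "X \<noteq> {}" using X(3) by blast
      fix y assume y: "y \<in> X"
      obtain d where d: "d \<in> D" "L y - d \<in> X" using X(2)[OF y] by blast
      have "\<nu> y = \<nu> (B ((L y - d) + d))" by simp
      also have "\<dots> \<le> \<rho> * \<nu> ((L y - d) + d)" by (rule \<nu>)
      also have "\<dots> \<le> \<rho> * (\<nu> (L y - d) + \<nu> d)" by (intro mult_left_mono \<nu>)
      also have "\<dots> \<le> \<rho> * (s + m')" by (intro mult_left_mono add_mono le_s d m' \<nu>(1))
      finally show "\<nu> y \<le> \<rho> * ((SUP y\<in>X. \<nu> y) + m')" by (simp add: s_def)
    qed
    then have "s * (1 - \<rho>) \<le> \<rho> * m'" by (simp add: algebra_simps)
    then have "s \<le> \<rho> * m' / (1 - \<rho>)" using \<nu>(2) by (simp add: pos_le_divide_eq)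
    moreover have "norm x \<le> s" using \<nu>(4)[of x] le_s[OF X(3)] by linarith
    ultimately show ?thesis by linarith
  qed
  then show ?thesis by (auto simp: bounded_iff)
qed

text \<open>Maximality gives closedness: continuations survive in the closure because the closure
  plus the finite set \<open>D\<close> is compact, so the closure is itself a witness set.\<close>

lemma compact_attractor:
  assumes "finite D"
  shows "compact (attractor D)"
proof -
  have bd: "bounded (attractor D)" by (intro bounded_attractor finite_imp_bounded assms)
  have "closure (attractor D) \<subseteq> attractor D"
  proof (rule subset_attractor)
    show "bounded (closure (attractor D))" using bd by (rule bounded_closure)
    fix x assume x: "x \<in> closure (attractor D)"
    have "compact (closure (attractor D) + D)"
    proof -
      have "closure (attractor D) + D = (\<Union>x\<in>closure (attractor D). \<Union>y\<in>D. {x + y})"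
        by (auto simp: set_plus_def)
      then show ?thesis
        using compact_sums'[of "closure (attractor D)" D] bd finite_imp_compact[OF assms]
        by (simp add: compact_closure)
    qed
    then have "closed (closure (attractor D) + D)" by (rule compact_imp_closed)
    moreover have "L ` attractor D \<subseteq> closure (attractor D) + D"
      unfolding attractor_eq by (intro set_plus_mono2 closure_subset order_refl)
    ultimately have "closure (L ` attractor D) \<subseteq> closure (attractor D) + D"
      by (intro closure_minimal)
    moreover have "L x \<in> closure (L ` attractor D)"
      using closure_linear_image_subset[OF linear_L, of "attractor D"] x by blast
    ultimately have "L x \<in> closure (attractor D) + D" by blast
    then obtain t d where "t \<in> closure (attractor D)" "d \<in> D" "L x = t + d"
      by (rule set_plus_elim)
    then show "\<exists>d\<in>D. L x - d \<in> closure (attractor D)" by (auto intro!: bexI[of _ d])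
  qed
  then have "closed (attractor D)" using closure_subset_eq by blast
  then show ?thesis using bd by (simp add: compact_eq_bounded_closed)
qed

text \<open>The fixed point of the map sending \<open>x\<close> to \<open>B (x + d)\<close> belongs
  to the attractor. It exists because \<open>L x = x\<close> would make the iterates of
  \<open>B\<close> at \<open>x\<close> constant, so \<open>L - id\<close> is injective and hence
  surjective.\<close>

lemma attractor_nonempty:
  assumes "D \<noteq> {}"
  shows "attractor D \<noteq> {}"
proof -
  obtain d where d: "d \<in> D" using assms by blast
  have lin: "linear (\<lambda>x. L x - x)" by (intro linear_compose_sub linear_L linear_id[unfolded id_def])
  have "inj (\<lambda>x. L x - x)"
    unfolding linear_injective_0[OF lin]
  proof (intro allI impI)
    fix x assume "L x - x = 0"
    then have Bx: "B x = x" using B_L[of x] by simp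
    have "(B ^^ n) x = x" for n by (induction n) (auto simp: Bx)
    then have "(\<lambda>n::nat. x) \<longlonglongrightarrow> 0" using iterates_tendsto_0[of x] by simp
    then show "x = 0" by (simp add: LIMSEQ_const_iff)
  qed
  then have "surj (\<lambda>x. L x - x)" using lin linear_injective_imp_surjective by blast
  from surjD[OF this, of d] obtain x where "d = L x - x" by blast
  then have "L x - d = x" by (simp add: algebra_simps)
  then have "{x} \<subseteq> attractor D" using d by (intro subset_attractor) (auto intro!: bexI[of _ d])
  then show ?thesis by blast
qed

text \<open>One inclusion is maximality. For the other, every point of the attractor is within
  \<rho>^n c' of the closed set \<open>T\<close>, for all n.\<close>

lemma attractor_unique:
  assumes "compact T" "T \<noteq> {}" "L ` T = T + D" "finite D"
  shows "T = attractor D"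
proof
  show "T \<subseteq> attractor D"
  proof (rule subset_attractor)
    show "bounded T" using assms(1) by (rule compact_imp_bounded)
    fix x assume "x \<in> T"
    then have "L x \<in> T + D" using assms(3) by blast
    then obtain t d where "t \<in> T" "d \<in> D" "L x = t + d" by (rule set_plus_elim)
    then show "\<exists>d\<in>D. L x - d \<in> T" by (auto intro!: bexI[of _ d])
  qed
  obtain \<nu> \<rho> C where \<nu>: "0 \<le> \<rho>" "\<rho> < 1" "\<And>x y. \<nu> (x + y) \<le> \<nu> x + \<nu> y"
    "\<And>x. norm x \<le> \<nu> x" "\<And>x. \<nu> x \<le> C * norm x" "\<And>x. \<nu> (B x) \<le> \<rho> * \<nu> x"
    using adapted_norm by metis
  obtain t0 where t0: "t0 \<in> T" using assms(2) by blast
  obtain c where c: "\<And>x. x \<in> attractor D \<Longrightarrow> norm x \<le> c"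
    using bounded_attractor[OF finite_imp_bounded[OF assms(4)]] by (auto simp: bounded_iff)
  define c' where "c' = max 0 C * (\<bar>c\<bar> + norm t0)"
  \<comment> \<open>Induction step: continue \<open>x\<close> by a digit \<open>d\<close>,
    approximate \<open>L x - d\<close> by \<open>t\<close>, and pull \<open>t + d\<close> back into
    \<open>T\<close>, which gains one factor \<rho>.\<close>
  have approx: "\<forall>x\<in>attractor D. \<exists>t\<in>T. \<nu> (x - t) \<le> \<rho> ^ n * c'" for n
  proof (induction n)
      case 0
      have "\<nu> (x - t0) \<le> c'" if "x \<in> attractor D" for x
      proof -
        have "\<nu> (x - t0) \<le> C * norm (x - t0)" by (rule \<nu>)
        also have "\<dots> \<le> max 0 C * norm (x - t0)" by (intro mult_right_mono) auto
        also have "\<dots> \<le> c'" unfolding c'_def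
          using norm_triangle_ineq4[of x t0] c[OF that] by (intro mult_left_mono) auto
        finally show ?thesis .
      qed
      then show ?case using t0 by auto
    next
      case (Suc n)
      show ?case
      proof
        fix x assume "x \<in> attractor D"
        then obtain d where d: "d \<in> D" "L x - d \<in> attractor D" using attractor_step by blast
        then obtain t where t: "t \<in> T" "\<nu> (L x - d - t) \<le> \<rho> ^ n * c'" using Suc by blast
        have "t + d \<in> L ` T" using assms(3) t(1) d(1) by (auto intro: set_plus_intro)
        then obtain s where s: "s \<in> T" "t + d = L s" by blast
        have "x - s = B (L x - d - t)"
        proof -
          have "L x - d - t = L (x - s)" using s(2) by (simp add: linear_diff[OF linear_L] algebra_simps)
          then show ?thesis by simp
        qed
        then have "\<nu> (x - s) \<le> \<rho> * \<nu> (L x - d - t)" using \<nu>(6) by simp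
        also have "\<dots> \<le> \<rho> * (\<rho> ^ n * c')" by (intro mult_left_mono t \<nu>(1))
        finally show "\<exists>t\<in>T. \<nu> (x - t) \<le> \<rho> ^ Suc n * c'" using s(1) by (auto simp: mult.assoc)
      qed
    qed
  show "attractor D \<subseteq> T"
  proof
    fix x assume x: "x \<in> attractor D"
    have "(\<lambda>n. \<rho> ^ n * c') \<longlonglongrightarrow> 0 * c'" using \<nu>(1,2) by (intro tendsto_intros LIMSEQ_power_zero) auto
    then have lim: "(\<lambda>n. \<rho> ^ n * c') \<longlonglongrightarrow> 0" by simp
    have "\<exists>t\<in>T. dist t x < e" if "e > 0" for e
    proof -
      have "\<forall>\<^sub>F n in sequentially. \<rho> ^ n * c' < e" using lim that by (rule order_tendstoD)
      then obtain n where n: "\<rho> ^ n * c' < e" by (auto simp: eventually_sequentially)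
      obtain t where "t \<in> T" "\<nu> (x - t) \<le> \<rho> ^ n * c'" using approx x by blast
      then show ?thesis using n \<nu>(4)[of "x - t"] by (intro bexI[of _ t]) (auto simp: dist_norm norm_minus_commute)
    qed
    then have "x \<in> closure T" by (simp add: closure_approachable)
    then show "x \<in> T" using compact_imp_closed[OF assms(1)] by simp
  qed
qed

section \<open>Connectedness of the attractor and the graph on the digits\<close>

definition digit_related :: "'a set \<Rightarrow> 'a \<Rightarrow> 'a \<Rightarrow> bool" where
  "digit_related D d e \<longleftrightarrow> d \<in> D \<and> e \<in> D \<and> (\<exists>s\<in>attractor D. \<exists>t\<in>attractor D. d - e = s - t)"

lemma digit_related_sym: "digit_related D d e \<Longrightarrow> digit_related D e d"
  unfolding digit_related_def by (force simp: algebra_simps)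

lemma not_connected_attractor:
  assumes "finite D" "D = D1 \<union> D2" "D1 \<noteq> {}" "D2 \<noteq> {}"
    and sep: "\<And>d e. d \<in> D1 \<Longrightarrow> e \<in> D2 \<Longrightarrow> \<not> digit_related D d e"
  shows "\<not> connected (attractor D)"
proof
  let ?T = "attractor D"
  assume "connected ?T"
  then have conn: "connected (?T + D)"
    unfolding attractor_eq[symmetric]
    by (rule connected_linear_image[OF linear_L])
  have comp: "compact (?T + E)" if "finite E" for E
  proof -
    have "?T + E = (\<Union>x\<in>?T. \<Union>y\<in>E. {x + y})" by (auto simp: set_plus_def)
    then show ?thesis
      using compact_sums'[OF compact_attractor[OF assms(1)] finite_imp_compact[OF that]] by simp
  qed
  have "finite D1" "finite D2" using assms(1,2) by auto
  then have closed: "closed (?T + D1)" "closed (?T + D2)"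
    using comp compact_imp_closed by blast+
  have un: "?T + D = (?T + D1) \<union> (?T + D2)"
    unfolding assms(2) by (auto simp: set_plus_def)
  have disj: "(?T + D1) \<inter> (?T + D2) = {}"
  proof (rule ccontr)
    assume "(?T + D1) \<inter> (?T + D2) \<noteq> {}"
    then obtain s d t e where "s \<in> ?T" "d \<in> D1" "t \<in> ?T" "e \<in> D2" and eq: "s + d = t + e"
      by (auto simp: set_plus_def)
    moreover have "d - e = t - s" using eq by (simp add: algebra_simps)
    ultimately have "digit_related D d e" using assms(2) unfolding digit_related_def by blast
    then show False using sep \<open>d \<in> D1\<close> \<open>e \<in> D2\<close> by blast
  qed
  obtain t where "t \<in> ?T" using attractor_nonempty[of D] assms(2,3) by blast
  then have "?T + D1 \<noteq> {}" "?T + D2 \<noteq> {}" using assms(3,4) by (auto simp: set_plus_def)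
  then have "(?T + D1) \<inter> (?T + D) \<noteq> {}" "(?T + D2) \<inter> (?T + D) \<noteq> {}" unfolding un by blast+
  moreover have "(?T + D1) \<inter> (?T + D2) \<inter> (?T + D) = {}" "?T + D \<subseteq> (?T + D1) \<union> (?T + D2)"
    using disj un by blast+
  ultimately show False using conn closed unfolding connected_closed by blast
qed

text \<open>Points in the same level-n piece of the attractor are related in this way; recording
  only their difference avoids indexing the pieces by words of digits.\<close>

definition close_at :: "'a set \<Rightarrow> nat \<Rightarrow> 'a \<Rightarrow> 'a \<Rightarrow> bool" where
  "close_at D n u w \<longleftrightarrow> u \<in> attractor D \<and> w \<in> attractor D \<and>
     (\<exists>s\<in>attractor D. \<exists>t\<in>attractor D. u - w = (B ^^ n) (s - t))"

lemma close_at_Suc: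
  assumes "close_at D n u w" "d \<in> D"
  shows "close_at D (Suc n) (B (u + d)) (B (w + d))"
proof -
  obtain s t where st: "s \<in> attractor D" "t \<in> attractor D" "u - w = (B ^^ n) (s - t)"
    and uw: "u \<in> attractor D" "w \<in> attractor D"
    using assms(1) unfolding close_at_def by blast
  have "B (u + d) - B (w + d) = (B ^^ Suc n) (s - t)"
    using st(3) by (simp add: linear_diff[OF linear_B, symmetric])
  then show ?thesis using st(1,2) uw attractorI assms(2) unfolding close_at_def by blast
qed

text \<open>Induction on the level: a chain inside one piece \<open>B (T + d)\<close> is a shrunken
  copy of a chain one level up, and pieces of related digits share a point at which the chain can
  change over.\<close>

lemma attractor_chain:
  assumes conn: "\<And>d e. d \<in> D \<Longrightarrow> e \<in> D \<Longrightarrow> (digit_related D)\<^sup>*\<^sup>* d e"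
    and "x \<in> attractor D" "y \<in> attractor D"
  shows "(close_at D n)\<^sup>*\<^sup>* x y"
  using assms(2,3)
proof (induction n arbitrary: x y)
  case 0
  then have "close_at D 0 x y" unfolding close_at_def by auto
  then show ?case by blast
next
  case (Suc n)
  have same: "(close_at D (Suc n))\<^sup>*\<^sup>* (B (u + d)) (B (w + d))"
    if "d \<in> D" "u \<in> attractor D" "w \<in> attractor D" for u w d
    using Suc.IH[OF that(2,3)]
  proof (induction rule: rtranclp_induct)
    case base
    then show ?case by simp
  next
    case (step y z)
    have "close_at D (Suc n) (B (y + d)) (B (z + d))"
      using step(2) that(1) by (rule close_at_Suc)
    with step(3) show ?case by (rule rtranclp.rtrancl_into_rtrancl)
  qed
  have path: "(close_at D (Suc n))\<^sup>*\<^sup>* (B (u + d)) (B (w + e))"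
    if path: "(digit_related D)\<^sup>*\<^sup>* d e" and d: "d \<in> D" and u: "u \<in> attractor D" and w: "w \<in> attractor D" for u w d e
    using path w
  proof (induction arbitrary: w rule: rtranclp_induct)
    case base
    then show ?case by (rule same[OF d u])
  next
    case (step e e')
    from step(2) obtain s t where st: "e \<in> D" "e' \<in> D" "s \<in> attractor D" "t \<in> attractor D"
      "e - e' = s - t" unfolding digit_related_def by blast
    \<comment> \<open>This is the point common to the pieces of \<open>e\<close> and
      \<open>e'\<close>.\<close>
    have "B (t + e) = B (s + e')" using st(5) by (simp add: algebra_simps)
    then have "(close_at D (Suc n))\<^sup>*\<^sup>* (B (u + d)) (B (s + e'))" using step(3)[OF st(4)] by simp
    also have "(close_at D (Suc n))\<^sup>*\<^sup>* (B (s + e')) (B (w + e'))" by (rule same[OF st(2,3) step(4)])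
    finally show ?case .
  qed
  obtain d where d: "d \<in> D" "L x - d \<in> attractor D" using attractor_step Suc.prems(1) by blast
  obtain e where e: "e \<in> D" "L y - e \<in> attractor D" using attractor_step Suc.prems(2) by blast
  show ?case using path[OF conn[OF d(1) e(1)] d(1) d(2) e(2)] by simp
qed

text \<open>The two parts of a separation of a compact set have positive distance \<epsilon>, and a
  chain whose steps are shorter than \<epsilon> cannot cross from one to the other.\<close>

lemma connected_attractor:
  assumes "finite D" and conn: "\<And>d e. d \<in> D \<Longrightarrow> e \<in> D \<Longrightarrow> (digit_related D)\<^sup>*\<^sup>* d e"
  shows "connected (attractor D)"
proof (rule ccontr)
  let ?T = "attractor D"
  assume "\<not> connected ?T"
  have comp: "compact ?T" by (rule compact_attractor[OF assms(1)])
  then obtain U V where UV: "closed U" "closed V" "?T \<subseteq> U \<union> V" "U \<inter> V \<inter> ?T = {}"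
    "U \<inter> ?T \<noteq> {}" "V \<inter> ?T \<noteq> {}"
    using \<open>\<not> connected ?T\<close> unfolding connected_closed by blast
  have "compact (U \<inter> ?T)" "closed (V \<inter> ?T)" "(U \<inter> ?T) \<inter> (V \<inter> ?T) = {}"
    using UV comp by (auto simp: closed_Int_compact compact_imp_closed closed_Int)
  then obtain \<epsilon> where \<epsilon>: "\<epsilon> > 0" "\<And>u w. u \<in> U \<inter> ?T \<Longrightarrow> w \<in> V \<inter> ?T \<Longrightarrow> \<epsilon> \<le> dist u w"
    using separate_compact_closed[of "U \<inter> ?T" "V \<inter> ?T"] by blast
  obtain \<nu> \<rho> C where \<nu>: "0 \<le> \<rho>" "\<rho> < 1"
    "\<And>x. norm x \<le> \<nu> x" "\<And>x. \<nu> x \<le> C * norm x" "\<And>x. \<nu> (B x) \<le> \<rho> * \<nu> x"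
    using adapted_norm by metis
  obtain c where c: "\<And>x. x \<in> ?T \<Longrightarrow> norm x \<le> c"
    using compact_imp_bounded[OF comp] by (auto simp: bounded_iff)
  have pow: "\<nu> ((B ^^ n) x) \<le> \<rho> ^ n * \<nu> x" for n x
  proof (induction n)
    case (Suc n)
    have "\<nu> ((B ^^ Suc n) x) \<le> \<rho> * \<nu> ((B ^^ n) x)" using \<nu>(5) by simp
    also have "\<dots> \<le> \<rho> * (\<rho> ^ n * \<nu> x)" by (intro mult_left_mono Suc \<nu>(1))
    finally show ?case by (simp add: mult.assoc)
  qed simp
  define c' where "c' = \<bar>C\<bar> * (2 * c)"
  have "(\<lambda>n. \<rho> ^ n * c') \<longlonglongrightarrow> 0 * c'" using \<nu>(1,2) by (intro tendsto_intros LIMSEQ_power_zero) auto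
  then have "(\<lambda>n. \<rho> ^ n * c') \<longlonglongrightarrow> 0" by simp
  then have "\<forall>\<^sub>F n in sequentially. \<rho> ^ n * c' < \<epsilon>" using \<epsilon>(1) by (rule order_tendstoD)
  then obtain n where n: "\<rho> ^ n * c' < \<epsilon>" by (auto simp: eventually_sequentially)
  have small: "norm ((B ^^ n) (s - t)) < \<epsilon>" if "s \<in> ?T" "t \<in> ?T" for s t
  proof -
    have "norm ((B ^^ n) (s - t)) \<le> \<nu> ((B ^^ n) (s - t))" by (rule \<nu>)
    also have "\<dots> \<le> \<rho> ^ n * \<nu> (s - t)" by (rule pow)
    also have "\<dots> \<le> \<rho> ^ n * c'"
    proof (intro mult_left_mono)
      have "\<nu> (s - t) \<le> C * norm (s - t)" by (rule \<nu>)
      also have "\<dots> \<le> \<bar>C\<bar> * norm (s - t)" by (intro mult_right_mono) auto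
      also have "\<dots> \<le> c'" unfolding c'_def
        using norm_triangle_ineq4[of s t] c[OF that(1)] c[OF that(2)] by (intro mult_left_mono) auto
      finally show "\<nu> (s - t) \<le> c'" .
    qed (use \<nu>(1) in auto)
    finally show ?thesis using n by linarith
  qed
  obtain x y where x: "x \<in> U \<inter> ?T" and y: "y \<in> V \<inter> ?T" using UV by blast
  then have "x \<in> ?T" "y \<in> ?T" by auto
  with conn have "(close_at D n)\<^sup>*\<^sup>* x y" by (rule attractor_chain)
  then have "y \<in> U \<inter> ?T"
  proof (induction rule: rtranclp_induct)
    case base
    then show ?case by (rule x)
  next
    case (step u w)
    then have "dist u w < \<epsilon>" "w \<in> ?T" using small by (auto simp: dist_norm close_at_def)
    then show ?case using \<epsilon>(2)[of u w] step(3) UV(3) by auto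
  qed
  then show False using y UV(4) by blast
qed

text \<open>By uniqueness only the functional equation has to be checked; it comes from splitting
  \<open>L (s - t)\<close> as \<open>((L s - d) - (L t - e)) + (d - e)\<close>.\<close>

lemma attractor_differences:
  assumes "finite D" "D \<noteq> {}"
  shows "{s - t | s t. s \<in> attractor D \<and> t \<in> attractor D} = attractor {d - e | d e. d \<in> D \<and> e \<in> D}"
    (is "?T = attractor ?D")
proof (rule attractor_unique)
  have comp: "compact (attractor D)" by (rule compact_attractor[OF assms(1)])
  have "?T = (\<Union>x\<in>attractor D. \<Union>y\<in>attractor D. {x - y})" by auto
  then show "compact ?T" using compact_differences'[OF comp comp] by simp
  show "?T \<noteq> {}" using attractor_nonempty[OF assms(2)] by auto
  have "?D = (\<lambda>(d, e). d - e) ` (D \<times> D)" by auto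
  then show "finite ?D" using assms(1) by simp
  show "L ` ?T = ?T + ?D"
  proof (intro equalityI subsetI)
    fix y assume "y \<in> L ` ?T"
    then obtain s t where st: "s \<in> attractor D" "t \<in> attractor D" "y = L (s - t)" by blast
    obtain d where d: "d \<in> D" "L s - d \<in> attractor D" using attractor_step st(1) by blast
    obtain e where e: "e \<in> D" "L t - e \<in> attractor D" using attractor_step st(2) by blast
    have "((L s - d) - (L t - e)) + (d - e) \<in> ?T + ?D"
      using d e by (intro set_plus_intro) blast+
    then show "y \<in> ?T + ?D" using st(3) by (simp add: linear_diff[OF linear_L])
  next
    fix y assume "y \<in> ?T + ?D"
    then obtain s t d e where *: "s \<in> attractor D" "t \<in> attractor D" "d \<in> D" "e \<in> D"
      "y = (s - t) + (d - e)" by (auto elim!: set_plus_elim)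
    then have "y = L (B (s + d) - B (t + e))" by (simp add: linear_diff[OF linear_L])
    moreover have "B (s + d) - B (t + e) \<in> ?T" using * attractorI by blast
    ultimately show "y \<in> L ` ?T" by blast
  qed
qed

end

section \<open>Bounded solutions of quadratic recurrences\<close>

text \<open>The supremum M of |y| satisfies c M <= (a + b) M + B. The offsets \<open>i\<close> and
  \<open>j\<close> are left free so that the same estimate serves the recurrence, its root-squared
  form and its first-order factors.\<close>

lemma bounded_three_term:
  fixes y :: "nat \<Rightarrow> real"
  assumes "bounded (range y)" "0 \<le> a" "0 \<le> b" "a + b \<le> c"
    and "\<And>n. c * \<bar>y n\<bar> \<le> a * \<bar>y (n + i)\<bar> + b * \<bar>y (n + j)\<bar> + B"
  shows "(c - a - b) * \<bar>y n\<bar> \<le> B"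
proof -
  obtain K where K: "\<And>n. \<bar>y n\<bar> \<le> K" using assms(1) by (auto simp: bounded_iff)
  define M where "M = (SUP n. \<bar>y n\<bar>)"
  have le_M: "\<bar>y n\<bar> \<le> M" for n
    unfolding M_def using K by (intro cSUP_upper bdd_aboveI2[of _ _ K]) auto
  have bd: "c * \<bar>y n\<bar> \<le> (a + b) * M + B" for n
  proof -
    have "a * \<bar>y (n + i)\<bar> \<le> a * M" "b * \<bar>y (n + j)\<bar> \<le> b * M"
      using le_M assms(2,3) by (auto intro: mult_left_mono)
    then show ?thesis using assms(5)[of n] by (simp add: algebra_simps)
  qed
  have cM: "c * M \<le> (a + b) * M + B"
  proof (cases "c = 0")
    case True
    then show ?thesis using bd[of 0] assms(2-4) by simp
  next
    case False
    then have c: "c > 0" using assms(2-4) by linarith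
    have "M \<le> ((a + b) * M + B) / c" unfolding M_def
      using bd c by (intro cSUP_least) (auto simp: M_def pos_le_divide_eq mult.commute)
    then show ?thesis using c by (simp add: pos_le_divide_eq mult.commute)
  qed
  have "(c - a - b) * \<bar>y n\<bar> \<le> (c - a - b) * M"
    using le_M assms(4) by (intro mult_left_mono) auto
  also have "\<dots> \<le> B" using cM by (simp add: algebra_simps)
  finally show ?thesis .
qed

lemma bounded_three_term_int:
  fixes y :: "nat \<Rightarrow> int" and a b c B :: int
  assumes "\<And>n. \<bar>y n\<bar> \<le> K" "0 \<le> a" "0 \<le> b" "a + b \<le> c"
    and "\<And>n. c * \<bar>y n\<bar> \<le> a * \<bar>y (n + i)\<bar> + b * \<bar>y (n + j)\<bar> + B"
  shows "(c - a - b) * \<bar>y n\<bar> \<le> B"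
proof -
  have "\<bar>real_of_int (y n)\<bar> \<le> real_of_int K" for n
    using assms(1)[of n] by (metis of_int_abs of_int_le_iff)
  then have "bounded (range (\<lambda>n. real_of_int (y n)))"
    by (auto simp: bounded_iff)
  moreover have "real_of_int a + real_of_int b \<le> real_of_int c"
    using assms(4) unfolding of_int_add[symmetric] of_int_le_iff .
  moreover have "real_of_int c * \<bar>real_of_int (y n)\<bar> \<le> real_of_int a * \<bar>real_of_int (y (n + i))\<bar> +
      real_of_int b * \<bar>real_of_int (y (n + j))\<bar> + real_of_int B" for n
    using assms(5)[of n] unfolding of_int_abs[symmetric] of_int_mult[symmetric] of_int_add[symmetric] of_int_le_iff .
  ultimately have "(real_of_int c - real_of_int a - real_of_int b) * \<bar>real_of_int (y n)\<bar> \<le> real_of_int B"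
    using assms(2,3) by (intro bounded_three_term[of "\<lambda>n. real_of_int (y n)"]) simp_all
  then show ?thesis
    unfolding of_int_abs[symmetric] of_int_diff[symmetric] of_int_mult[symmetric] of_int_le_iff .
qed

locale bounded_orbit =
  fixes p q B K :: int and d :: "nat \<Rightarrow> int"
  assumes bounded: "\<bar>d n\<bar> \<le> K"
    and step: "\<bar>d (Suc (Suc n)) + p * d (Suc n) + q * d n\<bar> \<le> B"
begin

lemma simple_bound:
  assumes "\<bar>p\<bar> + 1 \<le> \<bar>q\<bar>"
  shows "(\<bar>q\<bar> - \<bar>p\<bar> - 1) * \<bar>d n\<bar> \<le> B"
proof -
  have "\<bar>q\<bar> * \<bar>d n\<bar> \<le> \<bar>p\<bar> * \<bar>d (n + 1)\<bar> + 1 * \<bar>d (n + 2)\<bar> + B" for n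
  proof -
    have "\<bar>q * d n\<bar> \<le> \<bar>p * d (Suc n)\<bar> + \<bar>d (Suc (Suc n))\<bar> + B" using step[of n] by linarith
    then show ?thesis by (simp add: abs_mult)
  qed
  from bounded_three_term_int[of d, OF bounded _ _ _ this] show ?thesis using assms by simp
qed

text \<open>Multiplying the characteristic polynomial \<open>x\<^sup>2 + p x + q\<close> by \<open>x\<^sup>2 - p x + q\<close> (Graeffe's
  root squaring) leaves only the even powers and so improves the bound when the roots are not real.\<close>

lemma graeffe_bound:
  assumes "0 < q" "\<bar>2 * q - p * p\<bar> + 1 \<le> q * q"
  shows "(q * q - \<bar>2 * q - p * p\<bar> - 1) * \<bar>d n\<bar> \<le> (1 + \<bar>p\<bar> + q) * B"
proof -
  let ?r = "\<lambda>n. d (Suc (Suc n)) + p * d (Suc n) + q * d n"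
  have "q * q * \<bar>d n\<bar> \<le> \<bar>2 * q - p * p\<bar> * \<bar>d (n + 2)\<bar> + 1 * \<bar>d (n + 4)\<bar> + (1 + \<bar>p\<bar> + q) * B" for n
  proof -
    have eq: "q * q * d n = ?r (Suc (Suc n)) - p * ?r (Suc n) + q * ?r n
        - (2 * q - p * p) * d (n + 2) - d (n + 4)"
      by (simp add: algebra_simps numeral_eq_Suc)
    have "\<bar>p * ?r (Suc n)\<bar> \<le> \<bar>p\<bar> * B"
      unfolding abs_mult by (intro mult_left_mono step) auto
    moreover have "\<bar>q * ?r n\<bar> \<le> q * B"
      using assms(1) unfolding abs_mult by (simp add: step)
    moreover have "\<bar>?r (Suc (Suc n))\<bar> \<le> B" by (rule step)
    moreover have "\<bar>q * q * d n\<bar> \<le> \<bar>?r (Suc (Suc n))\<bar> + \<bar>p * ?r (Suc n)\<bar> + \<bar>q * ?r n\<bar>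
        + \<bar>(2 * q - p * p) * d (n + 2)\<bar> + \<bar>d (n + 4)\<bar>"
      unfolding eq by linarith
    ultimately have "\<bar>q * q * d n\<bar> \<le> B + \<bar>p\<bar> * B + q * B + \<bar>(2 * q - p * p) * d (n + 2)\<bar> + \<bar>d (n + 4)\<bar>"
      by linarith
    then show ?thesis
      using assms(1) unfolding abs_mult by (simp add: distrib_right)
  qed
  from bounded_three_term_int[of d, OF bounded _ _ _ this] show ?thesis using assms by simp
qed

text \<open>With \<alpha>, \<beta> \<ge> 1 the roots, the recurrence is a composition of two
  first-order ones, through y(n) = d(n+1) - \<beta> d(n). Inverting them costs the factors \<alpha>
  - 1 and \<beta> - 1, whose product is the value 1 + p + q of the characteristic polynomial at
  1.\<close>

lemma real_roots_bound:
  assumes "p \<le> 0" "- p \<le> q" "4 * q \<le> p * p" "2 \<le> - p"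
  shows "(1 + p + q) * \<bar>d n\<bar> \<le> B"
proof -
  define P Q r where "P = - real_of_int p" and "Q = real_of_int q" and "r = sqrt (P * P - 4 * Q)"
  have disc: "0 \<le> P * P - 4 * Q"
  proof -
    have "real_of_int (4 * q) \<le> real_of_int (p * p)" using assms(3) unfolding of_int_le_iff .
    then show ?thesis by (simp add: P_def Q_def)
  qed
  have PQ: "P \<le> Q" "2 \<le> P" using assms(2,4) unfolding P_def Q_def by linarith+
  have r2: "r * r = P * P - 4 * Q" unfolding r_def using disc by simp
  have r0: "0 \<le> r" unfolding r_def using disc by simp
  \<comment> \<open>This says that the smaller root is at least 1. It holds because (P - 2)^2 - r^2
    = 4 (Q - P + 1).\<close>
  have "r \<le> P - 2"
  proof (rule power2_le_imp_le)
    show "r\<^sup>2 \<le> (P - 2)\<^sup>2" using r2 PQ by (simp add: power2_eq_square algebra_simps)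
  qed (use PQ in simp)
  define \<alpha> \<beta> where "\<alpha> = (P + r) / 2" and "\<beta> = (P - r) / 2"
  have ge1: "1 \<le> \<alpha>" "1 \<le> \<beta>" unfolding \<alpha>_def \<beta>_def using r0 \<open>r \<le> P - 2\<close> by auto
  have sum: "\<alpha> + \<beta> = P" by (simp add: \<alpha>_def \<beta>_def field_simps)
  have prod: "\<alpha> * \<beta> = Q" using r2 by (simp add: \<alpha>_def \<beta>_def field_simps)
  define x where "x = (\<lambda>n. real_of_int (d n))"
  define y where "y = (\<lambda>n. x (Suc n) - \<beta> * x n)"
  have xK: "\<bar>x n\<bar> \<le> real_of_int K" for n
    unfolding x_def using bounded[of n] by (metis of_int_abs of_int_le_iff)
  then have bx: "bounded (range x)" by (auto simp: bounded_iff)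
  have "\<bar>y n\<bar> \<le> real_of_int K + \<beta> * real_of_int K" for n
  proof -
    have "\<bar>y n\<bar> \<le> \<bar>x (Suc n)\<bar> + \<bar>\<beta> * x n\<bar>" unfolding y_def by linarith
    also have "\<dots> \<le> real_of_int K + \<beta> * real_of_int K"
      using xK ge1 by (intro add_mono) (auto simp: abs_mult intro: mult_left_mono)
    finally show ?thesis .
  qed
  then have "bounded (range y)" by (auto simp: bounded_iff)
  then have y_bound: "(\<alpha> - 1 - 0) * \<bar>y n\<bar> \<le> real_of_int B" for n
  proof (rule bounded_three_term)
    fix n
    have "y (Suc n) - \<alpha> * y n = x (Suc (Suc n)) - (\<alpha> + \<beta>) * x (Suc n) + (\<alpha> * \<beta>) * x n"
      by (simp add: y_def algebra_simps)
    also have "\<dots> = real_of_int (d (Suc (Suc n)) + p * d (Suc n) + q * d n)"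
      unfolding sum prod P_def Q_def x_def by (simp add: algebra_simps)
    finally have "\<bar>y (Suc n) - \<alpha> * y n\<bar> \<le> real_of_int B"
      using step[of n] by (metis of_int_abs of_int_le_iff)
    moreover have "\<bar>\<alpha> * y n\<bar> = \<alpha> * \<bar>y n\<bar>" using ge1 by (simp add: abs_mult)
    ultimately show "\<alpha> * \<bar>y n\<bar> \<le> 1 * \<bar>y (n + 1)\<bar> + 0 * \<bar>y (n + 0)\<bar> + real_of_int B"
      using ge1 by simp
  qed (use ge1 in auto)
  \<comment> \<open>The inequality for \<open>x\<close> is multiplied by \<alpha> - 1, so that the
    bound on \<open>y\<close> enters without a division.\<close>
  have "((\<alpha> - 1) * \<beta> - (\<alpha> - 1) - 0) * \<bar>x n\<bar> \<le> real_of_int B"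
  proof (rule bounded_three_term[OF bx])
    fix n
    have "\<beta> * \<bar>x n\<bar> \<le> \<bar>x (Suc n)\<bar> + \<bar>y n\<bar>"
    proof -
      have "\<beta> * \<bar>x n\<bar> = \<bar>\<beta> * x n\<bar>" using ge1 by (simp add: abs_mult)
      then show ?thesis unfolding y_def by linarith
    qed
    then have "(\<alpha> - 1) * (\<beta> * \<bar>x n\<bar>) \<le> (\<alpha> - 1) * (\<bar>x (Suc n)\<bar> + \<bar>y n\<bar>)"
      using ge1 by (intro mult_left_mono) auto
    then show "(\<alpha> - 1) * \<beta> * \<bar>x n\<bar> \<le> (\<alpha> - 1) * \<bar>x (n + 1)\<bar> + 0 * \<bar>x (n + 0)\<bar> + real_of_int B"
      using y_bound[of n] by (simp add: algebra_simps)
  qed (use ge1 mult_left_mono[of 1 \<beta> "\<alpha> - 1"] in auto)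
  moreover have "(\<alpha> - 1) * \<beta> - (\<alpha> - 1) - 0 = real_of_int (1 + p + q)"
    using sum prod unfolding P_def Q_def by (simp add: algebra_simps)
  ultimately have "real_of_int ((1 + p + q) * \<bar>d n\<bar>) \<le> real_of_int B"
    by (simp only: x_def of_int_mult of_int_abs)
  then show ?thesis by (simp only: of_int_le_iff)
qed

end

section \<open>Necessary conditions for an orbit starting with 0, l\<close>

locale digit_difference_orbit = bounded_orbit p q "\<bar>q\<bar> + l - 2" K d
  for p q l K :: int and d :: "nat \<Rightarrow> int" +
  assumes d_0: "d 0 = 0" and d_1: "d 1 = l" and l_ge_2: "2 \<le> l"
begin

lemma d_2_bounds: "d 2 + p * l \<le> \<bar>q\<bar> + l - 2" "- (\<bar>q\<bar> + l - 2) \<le> d 2 + p * l"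
  using step[of 0] d_0 d_1 by (simp_all add: numeral_2_eq_2)

lemma d_3_bounds: "d 3 + p * d 2 + q * l \<le> \<bar>q\<bar> + l - 2" "- (\<bar>q\<bar> + l - 2) \<le> d 3 + p * d 2 + q * l"
  using step[of 1] d_1 by (simp_all add: numeral_2_eq_2 numeral_3_eq_3)

text \<open>In terms of k = -(1 + p + q) and s = l - 2, the supremum bound at the term l gives s (k
  - 1) + k <= p + 1. The extreme case k = p + 1 is the infinite family; for k <= p the third term
  grows too fast, except for a few tiny values.\<close>

lemma no_orbit_negative:
  assumes "q \<le> - 3" "0 \<le> p" "p \<le> - q - 2"
  shows "l = 2 \<and> (- q = 2 * p + 2 \<or> (p = 1 \<and> q = - 3))"
proof -
  define k s where "k = - q - p - 1" and "s = l - 2"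
  have k: "1 \<le> k" and s: "0 \<le> s" using assms l_ge_2 by (auto simp: k_def s_def)
  have q: "q = - (p + k + 1)" and l: "l = s + 2" by (auto simp: k_def s_def)
  have bd: "k * \<bar>d n\<bar> \<le> p + k + 1 + s" for n
    using simple_bound[of n] assms k s by (simp add: q l)
  have "s * (k - 1) + k \<le> p + 1"
    using bd[of 1] d_1 s by (simp add: l algebra_simps)
  show ?thesis
  proof (cases "k \<le> p")
    case False
    have "0 \<le> s * (k - 1)" using k s by simp
    then have "k = p + 1" "s * (k - 1) = 0" using \<open>s * (k - 1) + k \<le> p + 1\<close> False by linarith+
    then show ?thesis using assms(1) q l by auto
  next
    case True
    have p: "1 \<le> p" using k True by simp
    have "d 2 \<le> p + k + 1 + s - p * l" using d_2_bounds(1) assms(1) q l by simp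
    then have "p * d 2 \<le> p * (p + k + 1 + s - p * l)" using p by (intro mult_left_mono) auto
    moreover have "d 3 + p * d 2 + q * l \<ge> - (p + k + 1 + s)" using d_3_bounds(2) assms(1) q l by simp
    ultimately have "d 3 \<ge> - q * l - p * (p + k + 1 + s - p * l) - (p + k + 1 + s)" by linarith
    also have "- q * l - p * (p + k + 1 + s - p * l) - (p + k + 1 + s) = p * p * s + 1 + k * (s + 1) + p * (p - k)"
      by (simp add: q l algebra_simps)
    finally have "k * (p * p * s + 1 + k * (s + 1) + p * (p - k)) \<le> k * \<bar>d 3\<bar>"
      using k by (intro mult_left_mono) auto
    also have "\<dots> \<le> p + k + 1 + s" by (rule bd)
    finally have main: "k * (p * p * s) + k * k * s + k * k + p * (k * (p - k)) \<le> p + 1 + s"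
      by (simp add: algebra_simps)
    have nonneg: "0 \<le> k * (p * p * s)" "s \<le> k * k * s"
      using k s mult_right_mono[of 1 "k * k" s] mult_mono[of 1 k 1 k] by auto
    have sm: "p \<le> 2 \<and> k \<le> 2"
    proof (cases "k = p")
      case True
      then have "p * p \<le> p + 1" using main nonneg by simp
      moreover have "2 * p \<le> p * p" if "2 \<le> p" using that by (intro mult_right_mono) auto
      ultimately have "\<not> 2 \<le> p" by linarith
      then show ?thesis using True by simp
    next
      case False
      \<comment> \<open>For 1 <= k <= p - 1 the concave function k (p - k) is at least its value p -
        1 at the ends of the range; this product encodes that.\<close>
      then have "0 \<le> (k - 1) * (p - k - 1)" using k True by simp
      then have "p - 1 \<le> k * (p - k)" by (simp add: algebra_simps)
      then have "p * (p - 1) \<le> p * (k * (p - k))" using p by (intro mult_left_mono) auto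
      moreover have "1 \<le> k * k" using k mult_mono[of 1 k 1 k] by simp
      ultimately have "p * (p - 1) \<le> p" using main nonneg by linarith
      then have "p - 1 \<le> 1" using p by (simp add: mult_le_cancel_left1)
      then show ?thesis using True by simp
    qed
    have d4: "d 4 + p * d 3 + q * d 2 \<le> - q + l - 2"
      using step[of 2] assms(1) by (simp add: numeral_eq_Suc)
    have d5: "- q + l - 2 \<ge> - (d 5 + p * d 4 + q * d 3)"
      using step[of 3] assms(1) by (simp add: numeral_eq_Suc)
    \<comment> \<open>These are q = -3, -4, -5. For the first only l = 3 must be excluded, as l = 2
      is allowed by the conclusion.\<close>
    consider "p = 1" "k = 1" | "p = 2" "k = 1" | "p = 2" "k = 2"
      using sm p k True by linarith
    then show ?thesis
    proof cases
      case 1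
      then have "s \<le> 1" using main by simp
      then consider "s = 0" | "s = 1" using s by linarith
      then show ?thesis
      proof cases
        case 2
        show ?thesis
          using d4 d5 d_2_bounds d_3_bounds bd[of 2] bd[of 3] bd[of 4] bd[of 5] 1 2 by (simp add: q l)
      qed (use 1 q l in simp)
    next
      case 2
      then have "s = 0" using main s by simp
      then show ?thesis
        using d4 d5 d_2_bounds d_3_bounds bd[of 2] bd[of 3] bd[of 4] bd[of 5] 2 by (simp add: q l)
    next
      case 3
      then show ?thesis using main s by simp
    qed
  qed
qed

text \<open>With k = q + p, the value of the characteristic polynomial at 1 is k + 1. The supremum
  bound at d 2 makes a sum of two nonnegative terms nonpositive, so s = 0 and either k = P - 2,
  which is the infinite family, or k = 0. In the latter case d 2 = P is forced, and d 3 then leaves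
  only P = 4.\<close>

lemma no_orbit_real_roots:
  assumes "3 \<le> q" "0 \<le> - p" "- p \<le> q" "4 * q \<le> p * p"
  shows "l = 2 \<and> (- 2 * p = q + 2 \<or> (p = - 4 \<and> q = 4))"
proof -
  define P k s where "P = - p" and "k = q + p" and "s = l - 2"
  have k: "0 \<le> k" and s: "0 \<le> s" using assms l_ge_2 by (auto simp: k_def s_def)
  have p: "p = - P" and q: "q = P + k" and l: "l = s + 2" by (auto simp: P_def k_def s_def)
  have P4: "4 \<le> P"
  proof (rule ccontr)
    assume "\<not> 4 \<le> P"
    then have "P * P \<le> 3 * 3" using assms(2) p by (intro mult_mono) auto
    then show False using assms(1,4) p by simp
  qed
  have bd: "(k + 1) * \<bar>d n\<bar> \<le> P + k + s" for n
    using real_roots_bound[of n] assms P4 k by (simp add: p q l algebra_simps)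
  have le: "k + k * s + 2 \<le> P" using bd[of 1] d_1 s by (simp add: l algebra_simps)
  have d2: "d 2 \<ge> P * l - (P + k + s)" using d_2_bounds(2) P4 k by (simp add: p q l)
  have "(k + 1) * (P * l - (P + k + s)) \<le> (k + 1) * \<bar>d 2\<bar>"
    using d2 k by (intro mult_left_mono) auto
  also have "\<dots> \<le> P + k + s" by (rule bd)
  finally have "k * (P - k - 2) + s * ((k + 1) * (P - 1) - 1) \<le> 0"
    by (simp add: l algebra_simps)
  moreover have "0 \<le> k * s" using k s by simp
  then have nn: "0 \<le> k * (P - k - 2)" using k le by (intro mult_nonneg_nonneg) auto
  moreover have "3 \<le> (k + 1) * (P - 1)" using mult_mono[of 1 "k + 1" 3 "P - 1"] k P4 by simp
  then have ns: "s * 2 \<le> s * ((k + 1) * (P - 1) - 1)" using s by (intro mult_left_mono) auto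
  ultimately have s0: "s = 0" and kP: "k * (P - k - 2) = 0" using s by linarith+
  show ?thesis
  proof (cases "k = 0")
    case False
    then show ?thesis using kP s0 by (simp add: p q l)
  next
    case True
    have d2': "d 2 = P" using d2 bd[of 2] True s0 by (simp add: l)
    have "d 3 \<ge> P * (P - 3)" using d_3_bounds(2) P4 True s0 d2' by (simp add: p q l algebra_simps)
    moreover have "d 3 \<le> P" using bd[of 3] True s0 by simp
    ultimately have "P * (P - 3) \<le> P * 1" by simp
    then have "P = 4" using P4 by (simp add: mult_le_cancel_left)
    then show ?thesis using True s0 by (simp add: p q l)
  qed
qed

text \<open>Only 35 pairs \<open>(P, q)\<close> survive the a priori bound. The terms of the recurrence used for each
  of them are the support of a Farkas certificate found by linear programming.\<close>

lemma no_orbit_complex_roots: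
  assumes "3 \<le> q" "0 \<le> - p" "- p \<le> q" "p * p < 4 * q"
  shows "l = 2 \<and> (- 2 * p = q + 2 \<or> (p = - 2 \<and> q = 3) \<or> (p = - 3 \<and> q = 3))"
proof -
  define P where "P = - p"
  have p: "p = - P" by (simp add: P_def)
  have P: "0 \<le> P" "P \<le> q" "P * P < 4 * q" using assms by (auto simp: p)
  \<comment> \<open>The bound at the term l reads (q - P - 2) l <= q - 2, and l is at least
    2.\<close>
  have qP: "q \<le> 2 * P + 2"
  proof (cases "P + 1 \<le> q")
    case True
    then have "(q - P - 1) * l \<le> q + l - 2" using simple_bound[of 1] d_1 l_ge_2 P by (simp add: p)
    then have "(q - P - 2) * l \<le> q - 2" by (simp add: algebra_simps)
    moreover have "(q - P - 2) * 2 \<le> (q - P - 2) * l" if "P + 2 \<le> q"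
      using that l_ge_2 by (intro mult_left_mono) auto
    ultimately show ?thesis using P by (cases "P + 2 \<le> q") auto
  qed (use P in simp)
  have "P \<le> 8"
  proof (rule ccontr)
    assume "\<not> P \<le> 8"
    \<comment> \<open>P = 9 is the first value with P^2 > 8 P + 8, whereas nonreal roots require P^2
      < 4 q <= 8 P + 8.\<close>
    then have "0 \<le> (P - 9) * (P + 1)" by simp
    then have "8 * P + 8 < P * P + 1" by (simp add: algebra_simps)
    then show False using P(3) qP by linarith
  qed
  \<comment> \<open>At an exceptional pair the goal reduces to \<open>l = 2\<close>; at every other
    pair a contradiction is derived.\<close>
  then consider "P = 0" | "P = 1" | "P = 2" | "P = 3" | "P = 4" | "P = 5" | "P = 6" | "P = 7" | "P = 8"
    using P(1) by linarith
  then show ?thesis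
  proof cases
    case 1
    then show ?thesis using P qP assms(1) by simp
  next
    case 2
    then consider "q = 3" | "q = 4"
      using P qP assms(1) by (simp; linarith)
    then show ?thesis
    proof cases
      case 1
      show ?thesis using l_ge_2 d_0 d_1 step[of 1] step[of 2] step[of 3] step[of 4] simple_bound[of 5] simple_bound[of 6]
        by (simp add: p \<open>P = 1\<close> \<open>q = 3\<close> numeral_eq_Suc; linarith)
    next
      case 2
      show ?thesis using l_ge_2 d_0 d_1 step[of 1] step[of 2] simple_bound[of 3] simple_bound[of 4]
        by (simp add: p \<open>P = 1\<close> \<open>q = 4\<close> numeral_eq_Suc; linarith)
    qed
  next
    case 3
    then consider "q = 3" | "q = 4" | "q = 5" | "q = 6"
      using P qP assms(1) by (simp; linarith)
    then show ?thesis
    proof cases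
      case 1
      show ?thesis using l_ge_2 d_0 d_1 step[of 1] step[of 2] step[of 3] step[of 4] step[of 5] step[of 6] graeffe_bound[of 7] graeffe_bound[of 8]
        by (simp add: p \<open>P = 2\<close> \<open>q = 3\<close> numeral_eq_Suc; linarith)
    next
      case 2
      show ?thesis using l_ge_2 d_0 d_1 step[of 1] step[of 2] graeffe_bound[of 4]
        by (simp add: p \<open>P = 2\<close> \<open>q = 4\<close> numeral_eq_Suc; linarith)
    next
      case 3
      show ?thesis using l_ge_2 d_0 d_1 step[of 1] step[of 2] graeffe_bound[of 3] graeffe_bound[of 4]
        by (simp add: p \<open>P = 2\<close> \<open>q = 5\<close> numeral_eq_Suc; linarith)
    next
      case 4
      show ?thesis using l_ge_2 d_0 d_1 step[of 1] step[of 2] graeffe_bound[of 3] graeffe_bound[of 4]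
        by (simp add: p \<open>P = 2\<close> \<open>q = 6\<close> numeral_eq_Suc; linarith)
    qed
  next
    case 4
    then consider "q = 3" | "q = 4" | "q = 5" | "q = 6" | "q = 7" | "q = 8"
      using P qP assms(1) by (simp; linarith)
    then show ?thesis
    proof cases
      case 1
      show ?thesis using l_ge_2 d_0 d_1 step[of 0] step[of 2] step[of 3] step[of 4] step[of 5] graeffe_bound[of 3] graeffe_bound[of 7]
        by (simp add: p \<open>P = 3\<close> \<open>q = 3\<close> numeral_eq_Suc; linarith)
    next
      case 2
      show ?thesis using l_ge_2 d_0 d_1 graeffe_bound[of 1]
        by (simp add: p \<open>P = 3\<close> \<open>q = 4\<close> numeral_eq_Suc; linarith)
    next
      case 3
      show ?thesis using l_ge_2 d_0 d_1 graeffe_bound[of 1]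
        by (simp add: p \<open>P = 3\<close> \<open>q = 5\<close> numeral_eq_Suc; linarith)
    next
      case 4
      show ?thesis using l_ge_2 d_0 d_1 graeffe_bound[of 1]
        by (simp add: p \<open>P = 3\<close> \<open>q = 6\<close> numeral_eq_Suc; linarith)
    next
      case 5
      show ?thesis using l_ge_2 d_0 d_1 graeffe_bound[of 1]
        by (simp add: p \<open>P = 3\<close> \<open>q = 7\<close> numeral_eq_Suc; linarith)
    next
      case 6
      show ?thesis using l_ge_2 d_0 d_1 graeffe_bound[of 1]
        by (simp add: p \<open>P = 3\<close> \<open>q = 8\<close> numeral_eq_Suc; linarith)
    qed
  next
    case 5
    then consider "q = 5" | "q = 6" | "q = 7" | "q = 8" | "q = 9" | "q = 10"
      using P qP assms(1) by (simp; linarith)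
    then show ?thesis
    proof cases
      case 1
      show ?thesis using l_ge_2 d_0 d_1 step[of 0] graeffe_bound[of 2]
        by (simp add: p \<open>P = 4\<close> \<open>q = 5\<close> numeral_eq_Suc; linarith)
    next
      case 2
      show ?thesis using l_ge_2 d_0 d_1 graeffe_bound[of 1]
        by (simp add: p \<open>P = 4\<close> \<open>q = 6\<close> numeral_eq_Suc; linarith)
    next
      case 3
      show ?thesis using l_ge_2 d_0 d_1 graeffe_bound[of 1]
        by (simp add: p \<open>P = 4\<close> \<open>q = 7\<close> numeral_eq_Suc; linarith)
    next
      case 4
      show ?thesis using l_ge_2 d_0 d_1 graeffe_bound[of 1]
        by (simp add: p \<open>P = 4\<close> \<open>q = 8\<close> numeral_eq_Suc; linarith)
    next
      case 5
      show ?thesis using l_ge_2 d_0 d_1 graeffe_bound[of 1]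
        by (simp add: p \<open>P = 4\<close> \<open>q = 9\<close> numeral_eq_Suc; linarith)
    next
      case 6
      show ?thesis using l_ge_2 d_0 d_1 graeffe_bound[of 1]
        by (simp add: p \<open>P = 4\<close> \<open>q = 10\<close> numeral_eq_Suc; linarith)
    qed
  next
    case 6
    then consider "q = 7" | "q = 8" | "q = 9" | "q = 10" | "q = 11" | "q = 12"
      using P qP assms(1) by (simp; linarith)
    then show ?thesis
    proof cases
      case 1
      show ?thesis using l_ge_2 d_0 d_1 step[of 0] graeffe_bound[of 2]
        by (simp add: p \<open>P = 5\<close> \<open>q = 7\<close> numeral_eq_Suc; linarith)
    next
      case 2
      show ?thesis using l_ge_2 d_0 d_1 graeffe_bound[of 1]
        by (simp add: p \<open>P = 5\<close> \<open>q = 8\<close> numeral_eq_Suc; linarith)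
    next
      case 3
      show ?thesis using l_ge_2 d_0 d_1 graeffe_bound[of 1]
        by (simp add: p \<open>P = 5\<close> \<open>q = 9\<close> numeral_eq_Suc; linarith)
    next
      case 4
      show ?thesis using l_ge_2 d_0 d_1 graeffe_bound[of 1]
        by (simp add: p \<open>P = 5\<close> \<open>q = 10\<close> numeral_eq_Suc; linarith)
    next
      case 5
      show ?thesis using l_ge_2 d_0 d_1 graeffe_bound[of 1]
        by (simp add: p \<open>P = 5\<close> \<open>q = 11\<close> numeral_eq_Suc; linarith)
    next
      case 6
      show ?thesis using l_ge_2 d_0 d_1 graeffe_bound[of 1]
        by (simp add: p \<open>P = 5\<close> \<open>q = 12\<close> numeral_eq_Suc; linarith)
    qed
  next
    case 7
    then consider "q = 10" | "q = 11" | "q = 12" | "q = 13" | "q = 14"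
      using P qP assms(1) by (simp; linarith)
    then show ?thesis
    proof cases
      case 1
      show ?thesis using l_ge_2 d_0 d_1 graeffe_bound[of 1]
        by (simp add: p \<open>P = 6\<close> \<open>q = 10\<close> numeral_eq_Suc; linarith)
    next
      case 2
      show ?thesis using l_ge_2 d_0 d_1 graeffe_bound[of 1]
        by (simp add: p \<open>P = 6\<close> \<open>q = 11\<close> numeral_eq_Suc; linarith)
    next
      case 3
      show ?thesis using l_ge_2 d_0 d_1 graeffe_bound[of 1]
        by (simp add: p \<open>P = 6\<close> \<open>q = 12\<close> numeral_eq_Suc; linarith)
    next
      case 4
      show ?thesis using l_ge_2 d_0 d_1 graeffe_bound[of 1]
        by (simp add: p \<open>P = 6\<close> \<open>q = 13\<close> numeral_eq_Suc; linarith)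
    next
      case 5
      show ?thesis using l_ge_2 d_0 d_1 graeffe_bound[of 1]
        by (simp add: p \<open>P = 6\<close> \<open>q = 14\<close> numeral_eq_Suc; linarith)
    qed
  next
    case 8
    then consider "q = 13" | "q = 14" | "q = 15" | "q = 16"
      using P qP assms(1) by (simp; linarith)
    then show ?thesis
    proof cases
      case 1
      show ?thesis using l_ge_2 d_0 d_1 graeffe_bound[of 1]
        by (simp add: p \<open>P = 7\<close> \<open>q = 13\<close> numeral_eq_Suc; linarith)
    next
      case 2
      show ?thesis using l_ge_2 d_0 d_1 graeffe_bound[of 1]
        by (simp add: p \<open>P = 7\<close> \<open>q = 14\<close> numeral_eq_Suc; linarith)
    next
      case 3
      show ?thesis using l_ge_2 d_0 d_1 graeffe_bound[of 1]
        by (simp add: p \<open>P = 7\<close> \<open>q = 15\<close> numeral_eq_Suc; linarith)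
    next
      case 4
      show ?thesis using l_ge_2 d_0 d_1 graeffe_bound[of 1]
        by (simp add: p \<open>P = 7\<close> \<open>q = 16\<close> numeral_eq_Suc; linarith)
    qed
  next
    case 9
    then consider "q = 17" | "q = 18"
      using P qP assms(1) by (simp; linarith)
    then show ?thesis
    proof cases
      case 1
      show ?thesis using l_ge_2 d_0 d_1 graeffe_bound[of 1]
        by (simp add: p \<open>P = 8\<close> \<open>q = 17\<close> numeral_eq_Suc; linarith)
    next
      case 2
      show ?thesis using l_ge_2 d_0 d_1 graeffe_bound[of 1]
        by (simp add: p \<open>P = 8\<close> \<open>q = 18\<close> numeral_eq_Suc; linarith)
    qed
  qed
qed

end

section \<open>Both signs of the linear coefficient\<close>

definition exceptional :: "int \<Rightarrow> int \<Rightarrow> bool" where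
  "exceptional p q \<longleftrightarrow> 2 * \<bar>p\<bar> = \<bar>q + 2\<bar> \<or>
     (p, q) \<in> {(1, -3), (-1, -3), (2, 3), (-2, 3), (3, 3), (-3, 3), (4, 4), (-4, 4)}"

lemma exceptional_uminus [simp]: "exceptional (- p) q \<longleftrightarrow> exceptional p q"
  by (auto simp: exceptional_def)

context digit_difference_orbit
begin

text \<open>Substituting -x for x in the characteristic polynomial alternates the signs of the
  solution. The exponent \<open>Suc n\<close> keeps the term of index 1 equal to l.\<close>

lemma reflect: "digit_difference_orbit (- p) q l K (\<lambda>n. (-1) ^ Suc n * d n)"
proof
  show "\<bar>(-1) ^ Suc n * d n\<bar> \<le> K" for n using bounded[of n] by (simp add: abs_mult)
  show "\<bar>(-1) ^ Suc (Suc (Suc n)) * d (Suc (Suc n)) + - p * ((-1) ^ Suc (Suc n) * d (Suc n)) + q * ((-1) ^ Suc n * d n)\<bar>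
      \<le> \<bar>q\<bar> + l - 2" for n
  proof -
    have "(-1) ^ Suc (Suc (Suc n)) * d (Suc (Suc n)) + - p * ((-1) ^ Suc (Suc n) * d (Suc n)) + q * ((-1) ^ Suc n * d n)
      = (-1) ^ Suc n * (d (Suc (Suc n)) + p * d (Suc n) + q * d n)"
      by (simp add: algebra_simps)
    then show ?thesis using step[of n] by (simp only: abs_mult power_abs power_one abs_minus_cancel abs_one mult_1)
  qed
qed (use d_0 d_1 l_ge_2 in auto)

lemma exceptional_of_negative:
  assumes "q \<le> - 3" "\<bar>p\<bar> \<le> - q - 2"
  shows "l = 2 \<and> exceptional p q"
proof (cases "0 \<le> p")
  case True
  then show ?thesis using no_orbit_negative assms by (auto simp: exceptional_def)
next
  case False
  then show ?thesis using digit_difference_orbit.no_orbit_negative[OF reflect] assms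
    by (auto simp: exceptional_def)
qed

lemma exceptional_of_nonpositive:
  assumes "3 \<le> q" "0 \<le> - p" "- p \<le> q"
  shows "l = 2 \<and> exceptional p q"
proof (cases "4 * q \<le> p * p")
  case True
  then show ?thesis using no_orbit_real_roots assms by (auto simp: exceptional_def)
next
  case False
  then show ?thesis using no_orbit_complex_roots assms by (auto simp: exceptional_def)
qed

lemma exceptional_of_positive:
  assumes "3 \<le> q" "\<bar>p\<bar> \<le> q"
  shows "l = 2 \<and> exceptional p q"
  using exceptional_of_nonpositive digit_difference_orbit.exceptional_of_nonpositive[OF reflect] assms
  by (cases "p \<le> 0") auto

end

text \<open>A pair \<open>(x, y)\<close> stands for two consecutive terms of a solution, so that a finite set of pairs
  closed under some admissible continuation encodes a bounded solution.\<close>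

definition sustained :: "int \<Rightarrow> int \<Rightarrow> int \<Rightarrow> (int \<times> int) set \<Rightarrow> bool" where
  "sustained p q B S \<longleftrightarrow> finite S \<and>
     (\<forall>x y. (x, y) \<in> S \<longrightarrow> (\<exists>z. (y, z) \<in> S \<and> \<bar>z + p * y + q * x\<bar> \<le> B))"

lemma sustained_imp_bounded_orbit:
  assumes "sustained p q B S" "(x, y) \<in> S"
  obtains K d where "bounded_orbit p q B K d" "d 0 = x" "d 1 = y"
proof -
  \<comment> \<open>The clause for \<open>n = 0\<close> pins the initial pair, which dependent
    choice would otherwise leave free.\<close>
  have "\<exists>f. \<forall>n. (f n \<in> S \<and> (n = 0 \<longrightarrow> f n = (x, y))) \<and>
      (snd (f n) = fst (f (Suc n)) \<and> \<bar>snd (f (Suc n)) + p * snd (f n) + q * fst (f n)\<bar> \<le> B)"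
  proof (rule dependent_nat_choice)
    show "\<exists>w. w \<in> S \<and> ((0::nat) = 0 \<longrightarrow> w = (x, y))" using assms(2) by blast
    fix w :: "int \<times> int" and n :: nat
    assume w: "w \<in> S \<and> (n = 0 \<longrightarrow> w = (x, y))"
    obtain a b where ab: "w = (a, b)" by (cases w)
    with w assms(1) obtain c where c: "(b, c) \<in> S" "\<bar>c + p * b + q * a\<bar> \<le> B"
      unfolding sustained_def by blast
    show "\<exists>w'. (w' \<in> S \<and> (Suc n = 0 \<longrightarrow> w' = (x, y))) \<and>
        (snd w = fst w' \<and> \<bar>snd w' + p * snd w + q * fst w\<bar> \<le> B)"
      using c ab by (intro exI[of _ "(b, c)"]) simp
  qed
  then obtain f where f: "\<And>n. f n \<in> S" "f 0 = (x, y)" "\<And>n. snd (f n) = fst (f (Suc n))"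
    "\<And>n. \<bar>snd (f (Suc n)) + p * snd (f n) + q * fst (f n)\<bar> \<le> B" by blast
  define K where "K = Max ((\<lambda>w. \<bar>fst w\<bar>) ` S)"
  have "finite S" using assms(1) by (simp add: sustained_def)
  then have "\<bar>fst (f n)\<bar> \<le> K" for n
    unfolding K_def using f(1) by (intro Max_ge) auto
  then have "bounded_orbit p q B K (\<lambda>n. fst (f n))"
    using f(3,4) by unfold_locales (simp_all add: f(3)[symmetric])
  then show ?thesis using f(2) f(3)[of 0] by (intro that) auto
qed

text \<open>Because m <= l - 2, the residual bound |q| + m implies the bound |q| + l - 2 of the
  orbit analysis. That analysis returns l = 2, whence m = 0.\<close>

lemma exceptional_of_sustained:
  assumes "sustained p q (\<bar>q\<bar> + m) S" "(0, l) \<in> S" "m + 2 \<le> l" "0 \<le> m" "3 \<le> \<bar>q\<bar>"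
    and "0 < q \<Longrightarrow> \<bar>p\<bar> \<le> q" "q < 0 \<Longrightarrow> \<bar>p\<bar> \<le> - q - 2"
  shows "m = 0 \<and> exceptional p q"
proof -
  obtain K d where d: "bounded_orbit p q (\<bar>q\<bar> + m) K d" "d 0 = 0" "d 1 = l"
    using sustained_imp_bounded_orbit assms(1,2) .
  interpret bounded_orbit p q "\<bar>q\<bar> + m" K d by (rule d(1))
  interpret digit_difference_orbit p q l K d
  proof
    show "\<bar>d (Suc (Suc n)) + p * d (Suc n) + q * d n\<bar> \<le> \<bar>q\<bar> + l - 2" for n
      using step[of n] assms(3) by linarith
  qed (use d assms bounded in auto)
  have "l = 2 \<and> exceptional p q"
    using exceptional_of_negative exceptional_of_positive assms(5-7) by (cases "0 < q") auto
  then show ?thesis using assms(3,4) by simp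
qed

text \<open>A pair does not know the parity of its position in the sequence, so both sign patterns
  of every pair are included.\<close>

lemma sustained_reflect:
  assumes "sustained p q B S"
  shows "sustained (- p) q B ((\<lambda>(x, y). (x, - y)) ` S \<union> (\<lambda>(x, y). (- x, y)) ` S)"
proof -
  have "\<exists>z'. (y', z') \<in> (\<lambda>(x, y). (x, - y)) ` S \<union> (\<lambda>(x, y). (- x, y)) ` S \<and> \<bar>z' + - p * y' + q * x'\<bar> \<le> B"
    if xy: "(x', y') \<in> (\<lambda>(x, y). (x, - y)) ` S \<union> (\<lambda>(x, y). (- x, y)) ` S" for x' y'
  proof -
    from xy obtain x y where S: "(x, y) \<in> S" and or: "x' = x \<and> y' = - y \<or> x' = - x \<and> y' = y" by auto
    obtain z where z: "(y, z) \<in> S" "\<bar>z + p * y + q * x\<bar> \<le> B"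
      using assms S unfolding sustained_def by blast
    from or show ?thesis
    proof
      assume *: "x' = x \<and> y' = - y"
      have "(y', z) \<in> (\<lambda>(x, y). (- x, y)) ` S" using z(1) * by force
      then show ?thesis using z(2) * by (intro exI[of _ z]) auto
    next
      assume *: "x' = - x \<and> y' = y"
      have "(y', - z) \<in> (\<lambda>(x, y). (x, - y)) ` S" using z(1) * by force
      moreover have "\<bar>- z + - p * y' + q * x'\<bar> = \<bar>z + p * y + q * x\<bar>"
        using * by simp
      ultimately show ?thesis using z(2) by (intro exI[of _ "- z"]) simp
    qed
  qed
  then show ?thesis using assms unfolding sustained_def by blast
qed

text \<open>The orbit is 0, l, l, l, ...; the hypotheses bound its two distinct residuals.\<close>

lemma sustained_constant:
  assumes "\<bar>(1 + p) * l\<bar> \<le> B" "\<bar>(1 + p + q) * l\<bar> \<le> B"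
  shows "sustained p q B {(0, l), (l, l)}"
  using assms by (auto simp: sustained_def algebra_simps)

lemma sustained_of_exceptional:
  assumes "exceptional p q" "3 \<le> \<bar>q\<bar>" "l = 1 \<or> l = 2"
  shows "\<exists>S. sustained p q \<bar>q\<bar> S \<and> (0, l) \<in> S"
proof -
  have refl: "\<exists>S. sustained p q \<bar>q\<bar> S \<and> (0, l) \<in> S"
    if "\<exists>S. sustained (- p) q \<bar>q\<bar> S \<and> (0, l) \<in> S" for p
  proof -
    from that obtain S where S: "sustained (- p) q \<bar>q\<bar> S" "(0, l) \<in> S" by blast
    have "(0, l) \<in> (\<lambda>(x, y). (- x, y)) ` S" using S(2) by force
    then show ?thesis using sustained_reflect[OF S(1)] unfolding minus_minus by blast
  qed
  have const: "\<exists>S. sustained p q \<bar>q\<bar> S \<and> (0, l) \<in> S"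
    if "\<bar>(1 + p) * l\<bar> \<le> \<bar>q\<bar>" "\<bar>(1 + p + q) * l\<bar> \<le> \<bar>q\<bar>" for p
    using sustained_constant[OF that] by blast
  have pos: "\<exists>S. sustained p q \<bar>q\<bar> S \<and> (0, l) \<in> S"
    if p: "exceptional p q" "0 < q \<Longrightarrow> p \<le> 0" "q < 0 \<Longrightarrow> 0 \<le> p" for p
  proof -
    from p(1) consider "2 * \<bar>p\<bar> = \<bar>q + 2\<bar>" | "p = 1" "q = - 3" | "p = - 2" "q = 3"
      | "p = - 3" "q = 3" | "p = - 4" "q = 4"
      using p(2,3) by (auto simp: exceptional_def)
    then show ?thesis
    proof cases
      case 1
      \<comment> \<open>With the normalised signs, 2 (1 + p) = -q and 2 (1 + p + q) = q throughout
        the family, so the constant orbit with l = 2 meets the bound |q| with equality.\<close>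
      show ?thesis
        by (rule const; use assms(3) in \<open>rule disjE\<close>) (use 1 p(2,3) assms(2) in \<open>simp; linarith\<close>)+
    next
      case 2
      \<comment> \<open>In this and the remaining cases the constant orbit works for l = 1 but
        violates the bound for l = 2, so an explicit orbit is given: here 0, 2, 1, 2, 1, ...\<close>
      have "sustained 1 (-3) 3 {(0, 2), (2, 1), (1, 2)}"
        by (auto simp: sustained_def)
      then show ?thesis using assms(3) const[of p] 2 by auto
    next
      case 3
      \<comment> \<open>After the initial 0 the orbit has period 6 and satisfies z = y - x on
        consecutive terms x, y, z.\<close>
      have "sustained (-2) 3 3 {(0, 2), (2, 1), (1, -1), (-1, -2), (-2, -1), (-1, 1), (1, 2)}"
        by (auto simp: sustained_def)
      then show ?thesis using assms(3) const[of p] 3 by auto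
    next
      case 4
      have "sustained (-3) 3 3 {(0, 2), (2, 3), (3, 3)}"
        by (auto simp: sustained_def)
      then show ?thesis using assms(3) const[of p] 4 by auto
    next
      case 5
      have "sustained (-4) 4 4 {(0, 2), (2, 4), (4, 4)}"
        by (auto simp: sustained_def)
      then show ?thesis using assms(3) const[of p] 5 by auto
    qed
  qed
  show ?thesis
    using pos[of p] refl[of p] pos[of "- p"] assms(1,2) by (cases "0 < q"; cases "0 \<le> p") auto
qed

section \<open>Expanding integer matrices of size two\<close>

lemma charpoly_2:
  fixes A :: "int ^ 2 ^ 2"
  assumes "charpoly A = [:q, p, 1:]"
  shows "p = - (A $ 1 $ 1 + A $ 2 $ 2)" "q = A $ 1 $ 1 * A $ 2 $ 2 - A $ 1 $ 2 * A $ 2 $ 1"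
  using assms by (simp_all add: charpoly_def det_2 map_matrix_def mat_def algebra_simps)

lemma cayley_hamilton_2:
  fixes A :: "int ^ 2 ^ 2" and x :: "real ^ 2"
  assumes "charpoly A = [:q, p, 1:]"
  shows "real_mat A *v (real_mat A *v x) + real_of_int p *\<^sub>R (real_mat A *v x) + real_of_int q *\<^sub>R x = 0"
  by (simp add: charpoly_2[OF assms] vec_eq_iff forall_2 matrix_vector_mult_def sum_2 real_mat_def
      map_matrix_def algebra_simps)

lemma det_real_mat:
  fixes A :: "int ^ 2 ^ 2"
  assumes "charpoly A = [:q, p, 1:]"
  shows "det (real_mat A) = real_of_int q"
  by (simp add: charpoly_2[OF assms] det_2 real_mat_def map_matrix_def)

lemma norm_root_gt_1:
  fixes A :: "int ^ 2 ^ 2" and k :: complex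
  assumes "expanding (real_mat A)" "charpoly A = [:q, p, 1:]"
    and "k * k + of_int p * k + of_int q = 0"
  shows "norm k > 1"
proof -
  let ?C = "map_matrix complex_of_real (real_mat A)"
  have "det (?C - mat k) = k * k + of_int p * k + of_int q"
    by (simp add: charpoly_2[OF assms(2)] det_2 real_mat_def map_matrix_def mat_def algebra_simps)
  then have "\<not> invertible (?C - mat k)" using assms(3) by (simp add: invertible_det_nz)
  then obtain x where x: "(?C - mat k) *v x = 0" "x \<noteq> 0"
    using matrix_left_invertible_ker[of "?C - mat k"] invertible_left_inverse[of "?C - mat k"] by blast
  have "?C *v x = k *s x"
    using x(1) by (simp add: vec_eq_iff forall_2 matrix_vector_mult_def sum_2 mat_def algebra_simps)
  then have "eigenvalue ?C k" using x(2) unfolding eigenvalue_def by blast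
  then show ?thesis using assms(1) unfolding expanding_def by blast
qed

lemma real_root_gt_1:
  fixes A :: "int ^ 2 ^ 2" and r :: real
  assumes "expanding (real_mat A)" "charpoly A = [:q, p, 1:]"
    and "r * r + of_int p * r + of_int q = 0"
  shows "\<bar>r\<bar> > 1"
proof -
  have "complex_of_real (r * r + of_int p * r + of_int q) = 0" using assms(3) by simp
  then have "complex_of_real r * complex_of_real r + of_int p * complex_of_real r + of_int q = 0" by simp
  from norm_root_gt_1[OF assms(1,2) this] show ?thesis by simp
qed

text \<open>The characteristic polynomial has no root in [-1, 1], so its values at 1 and -1 have the
  sign of its value q at 0. Integrality sharpens the strict inequalities to the stated ones.\<close>

lemma expanding_imp_linear_coeff_bound:
  fixes A :: "int ^ 2 ^ 2"
  assumes "expanding (real_mat A)" "charpoly A = [:q, p, 1:]"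
  shows "0 < q \<Longrightarrow> \<bar>p\<bar> \<le> q" "q < 0 \<Longrightarrow> \<bar>p\<bar> \<le> - q - 2"
proof -
  define f where "f = (\<lambda>r::real. r * r + of_int p * r + of_int q)"
  have cont: "continuous_on S f" for S unfolding f_def by (intro continuous_intros)
  have no_root: "f r \<noteq> 0" if "-1 \<le> r" "r \<le> 1" for r
    using real_root_gt_1[OF assms, of r] that by (auto simp: f_def)
  have f0: "f 0 = of_int q" by (simp add: f_def)
  have f1: "f 1 = of_int (1 + p + q)" "f (- 1) = of_int (1 - p + q)" by (simp_all add: f_def)
  { assume q: "0 < q"
    have "0 < f 1"
    proof (rule ccontr)
      assume "\<not> 0 < f 1"
      then obtain r where "0 \<le> r" "r \<le> 1" "f r = 0"
        using IVT2'[of f 1 0 0] cont f0 q by auto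
      then show False using no_root[of r] by simp
    qed
    moreover have "0 < f (- 1)"
    proof (rule ccontr)
      assume "\<not> 0 < f (- 1)"
      then obtain r where "- 1 \<le> r" "r \<le> 0" "f r = 0"
        using IVT'[of f "- 1" 0 0] cont f0 q by auto
      then show False using no_root[of r] by simp
    qed
    ultimately show "\<bar>p\<bar> \<le> q" unfolding f1 of_int_0_less_iff by linarith }
  { assume q: "q < 0"
    have "f 1 < 0"
    proof (rule ccontr)
      assume "\<not> f 1 < 0"
      then obtain r where "0 \<le> r" "r \<le> 1" "f r = 0"
        using IVT'[of f 0 0 1] cont f0 q by auto
      then show False using no_root[of r] by simp
    qed
    moreover have "f (- 1) < 0"
    proof (rule ccontr)
      assume "\<not> f (- 1) < 0"
      then obtain r where "- 1 \<le> r" "r \<le> 0" "f r = 0"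
        using IVT2'[of f 0 0 "- 1"] cont f0 q by auto
      then show False using no_root[of r] by simp
    qed
    ultimately show "\<bar>p\<bar> \<le> - q - 2" unfolding f1 of_int_less_0_iff by linarith }
qed

section \<open>Decay of the iterates of the inverse\<close>

text \<open>The perturbation may decay at the same rate \<open>r\<close> as the contraction, so a
  term n r^n appears; this is what covers double eigenvalues.\<close>

lemma perturbed_contraction_tendsto_0:
  fixes u w :: "nat \<Rightarrow> 'a::real_normed_field"
  assumes "\<And>n. u (Suc n) = c * u n + w n" "\<And>n. norm (w n) \<le> C * r ^ n"
    and "norm c \<le> r" "0 < r" "r < 1"
  shows "u \<longlonglongrightarrow> 0"
proof -
  have bd: "norm (u n) \<le> norm (u 0) * r ^ n + (C / r) * (of_nat n * r ^ n)" for n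
  proof (induction n)
    case (Suc n)
    have "norm (u (Suc n)) \<le> norm c * norm (u n) + norm (w n)"
      unfolding assms(1) by (metis norm_mult norm_triangle_ineq)
    also have "\<dots> \<le> r * norm (u n) + C * r ^ n"
      using assms(2,3) by (intro add_mono mult_right_mono) auto
    also have "\<dots> \<le> r * (norm (u 0) * r ^ n + (C / r) * (of_nat n * r ^ n)) + C * r ^ n"
      using mult_left_mono[OF Suc, of r] assms(4) by (intro add_right_mono) simp
    also have "\<dots> = norm (u 0) * r ^ Suc n + (C / r) * (of_nat (Suc n) * r ^ Suc n)"
      using assms(4) by (simp add: field_simps)
    finally show ?case .
  qed simp
  have "(\<lambda>n. norm (u 0) * r ^ n + (C / r) * (of_nat n * r ^ n)) \<longlonglongrightarrow> norm (u 0) * 0 + (C / r) * 0"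
    using assms(4,5) by (intro tendsto_intros LIMSEQ_power_zero powser_times_n_limit_0) auto
  then have "(\<lambda>n. norm (u 0) * r ^ n + (C / r) * (of_nat n * r ^ n)) \<longlonglongrightarrow> 0" by simp
  then show ?thesis by (rule Lim_null_comparison[rotated]) (use bd in auto)
qed

text \<open>Splitting off one root leaves \<open>z\<close>, a geometric sequence with ratio
  1/\<beta>, and then \<open>u\<close> obeys a first-order recurrence with ratio 1/\<alpha>
  perturbed by \<open>z\<close>.\<close>

lemma recurrence_tendsto_0:
  fixes u :: "nat \<Rightarrow> complex"
  assumes "\<And>n. u n - (\<alpha> + \<beta>) * u (Suc n) + \<alpha> * \<beta> * u (Suc (Suc n)) = 0"
    and "1 < norm \<alpha>" "1 < norm \<beta>"
  shows "u \<longlonglongrightarrow> 0"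
proof -
  define z where "z = (\<lambda>n. u n - \<alpha> * u (Suc n))"
  have nz: "\<alpha> \<noteq> 0" "\<beta> \<noteq> 0" using assms(2,3) by auto
  have z_eq: "z n = \<beta> * z (Suc n)" for n using assms(1)[of n] by (simp add: z_def algebra_simps)
  have z_Suc: "z (Suc n) = inverse \<beta> * z n" for n unfolding z_eq[of n] using nz(2) by simp
  have z: "z n = inverse \<beta> ^ n * z 0" for n
    by (induction n) (simp_all add: z_Suc mult.assoc)
  define r where "r = max (norm (inverse \<alpha>)) (norm (inverse \<beta>))"
  show ?thesis
  proof (rule perturbed_contraction_tendsto_0[where c = "inverse \<alpha>" and w = "\<lambda>n. - inverse \<alpha> * z n"
        and C = "norm (inverse \<alpha>) * norm (z 0)" and r = r])
    show "u (Suc n) = inverse \<alpha> * u n + - inverse \<alpha> * z n" for n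
      using nz by (simp add: z_def right_diff_distrib flip: mult.assoc)
    show "norm (- inverse \<alpha> * z n) \<le> norm (inverse \<alpha>) * norm (z 0) * r ^ n" for n
    proof -
      have "norm (inverse \<beta>) ^ n \<le> r ^ n" by (intro power_mono) (auto simp: r_def)
      then have "norm (inverse \<alpha>) * norm (z 0) * norm (inverse \<beta>) ^ n \<le> norm (inverse \<alpha>) * norm (z 0) * r ^ n"
        by (intro mult_left_mono) auto
      then show ?thesis unfolding z[of n] by (simp add: norm_mult norm_power mult_ac)
    qed
    show "norm (inverse \<alpha>) \<le> r" by (simp add: r_def)
    show "0 < r" using nz by (simp add: r_def less_max_iff_disj)
    show "r < 1" using assms(2,3) by (simp add: r_def norm_inverse inverse_less_1_iff)
  qed
qed

text \<open>By Cayley-Hamilton each coordinate of the backward iterates obeys the reversed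
  recurrence, whose coefficients are the symmetric functions of the eigenvalues. This replaces a
  discussion of Jordan forms; complex numbers enter because the eigenvalues may be nonreal.\<close>

lemma expanding_inverse_iterates_tendsto_0:
  fixes A :: "int ^ 2 ^ 2" and B :: "real ^ 2 \<Rightarrow> real ^ 2"
  assumes "expanding (real_mat A)" "charpoly A = [:q, p, 1:]" and inv: "\<And>x. real_mat A *v B x = x"
  shows "(\<lambda>n. (B ^^ n) x) \<longlonglongrightarrow> 0"
proof -
  define s where "s = csqrt (of_int (p * p - 4 * q))"
  have s2: "s * s = of_int (p * p - 4 * q)"
    unfolding s_def using power2_csqrt[of "of_int (p * p - 4 * q)"] by (simp only: power2_eq_square)
  define \<alpha> \<beta> where "\<alpha> = (- of_int p + s) / 2" and "\<beta> = (- of_int p - s) / 2"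
  have roots: "\<alpha> * \<alpha> + of_int p * \<alpha> + of_int q = 0" "\<beta> * \<beta> + of_int p * \<beta> + of_int q = 0"
  proof -
    have "\<alpha> * \<alpha> + of_int p * \<alpha> + of_int q = (s * s - of_int (p * p - 4 * q)) / 4"
      "\<beta> * \<beta> + of_int p * \<beta> + of_int q = (s * s - of_int (p * p - 4 * q)) / 4"
      by (simp_all add: \<alpha>_def \<beta>_def field_simps)
    then show "\<alpha> * \<alpha> + of_int p * \<alpha> + of_int q = 0" "\<beta> * \<beta> + of_int p * \<beta> + of_int q = 0"
      using s2 by simp_all
  qed
  have sum: "\<alpha> + \<beta> = - of_int p" by (simp add: \<alpha>_def \<beta>_def field_simps)
  have prod: "\<alpha> * \<beta> = of_int q"
  proof -
    have "\<alpha> * \<beta> = (of_int (p * p) - s * s) / 4" by (simp add: \<alpha>_def \<beta>_def field_simps)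
    then show ?thesis using s2 by simp
  qed
  have "(\<lambda>n. (B ^^ n) x $ i) \<longlonglongrightarrow> 0" for i
  proof -
    have "(\<lambda>n. complex_of_real ((B ^^ n) x $ i)) \<longlonglongrightarrow> 0"
    proof (rule recurrence_tendsto_0[where \<alpha> = \<alpha> and \<beta> = \<beta>])
      fix n
      let ?y = "(B ^^ Suc (Suc n)) x"
      have "(B ^^ n) x + of_int p *\<^sub>R (B ^^ Suc n) x + of_int q *\<^sub>R ?y = 0"
        using cayley_hamilton_2[OF assms(2), of ?y] by (simp add: inv)
      then have "((B ^^ n) x + of_int p *\<^sub>R (B ^^ Suc n) x + of_int q *\<^sub>R ?y) $ i = 0" by simp
      then have "complex_of_real ((B ^^ n) x $ i + of_int p * ((B ^^ Suc n) x $ i) + of_int q * (?y $ i)) = 0"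
        by simp
      then show "complex_of_real ((B ^^ n) x $ i) - (\<alpha> + \<beta>) * complex_of_real ((B ^^ Suc n) x $ i)
          + \<alpha> * \<beta> * complex_of_real (?y $ i) = 0"
        unfolding sum prod by simp
    qed (use norm_root_gt_1[OF assms(1,2)] roots in auto)
    then show ?thesis by (simp add: tendsto_of_real_iff[where c = 0, simplified])
  qed
  then show ?thesis by (intro vec_tendstoI) simp
qed

section \<open>Collinear digit sets\<close>

text \<open>The integer pair \<open>(x, y)\<close> of consecutive terms of a solution of the recurrence is
  identified with the point \<open>(y + p x) v + x (L v)\<close> of the lattice spanned by \<open>v\<close> and \<open>L v\<close>:
  applying \<open>L\<close> and subtracting a multiple of \<open>v\<close> then amounts to passing to the next pair.\<close>

locale cyclic_expanding_map = expanding_map L B for L B :: "'a::euclidean_space \<Rightarrow> 'a" +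
  fixes v :: 'a and p q :: int
  assumes quadratic: "L (L v) + real_of_int p *\<^sub>R L v + real_of_int q *\<^sub>R v = 0"
    and cyclic: "\<And>a b. a *\<^sub>R v + b *\<^sub>R L v = 0 \<Longrightarrow> a = 0 \<and> b = 0"
begin

definition lattice_point :: "int \<times> int \<Rightarrow> 'a" where
  "lattice_point = (\<lambda>(x, y). real_of_int (y + p * x) *\<^sub>R v + real_of_int x *\<^sub>R L v)"

lemma L_lattice_point:
  "L (lattice_point (x, y)) - real_of_int \<delta> *\<^sub>R v = lattice_point (y, - \<delta> - p * y - q * x)"
proof -
  have "L (L v) = - real_of_int p *\<^sub>R L v - real_of_int q *\<^sub>R v"
    using quadratic by (simp add: algebra_simps eq_neg_iff_add_eq_0)
  moreover have "L (lattice_point (x, y)) = real_of_int (y + p * x) *\<^sub>R L v + real_of_int x *\<^sub>R L (L v)"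
    by (simp add: lattice_point_def linear_add[OF linear_L] linear_scale[OF linear_L])
  ultimately have "L (lattice_point (x, y)) = real_of_int (y + p * x) *\<^sub>R L v
      + real_of_int x *\<^sub>R (- real_of_int p *\<^sub>R L v - real_of_int q *\<^sub>R v)" by (simp only:)
  then show ?thesis by (simp add: lattice_point_def algebra_simps)
qed

text \<open>Independence of \<open>v\<close> and \<open>L v\<close> makes the coordinate map
  injective, hence bounded below, so boundedness in space bounds the integer coordinates.\<close>

lemma finite_lattice_points:
  assumes "bounded X"
  shows "finite {w. lattice_point w \<in> X}"
proof -
  define \<phi> where "\<phi> = (\<lambda>w::real \<times> real. fst w *\<^sub>R v + snd w *\<^sub>R L v)"
  have lin: "linear \<phi>" unfolding \<phi>_def by (rule linearI) (simp_all add: algebra_simps)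
  have "inj \<phi>"
    unfolding linear_injective_0[OF lin] by (auto simp: \<phi>_def zero_prod_def dest: cyclic)
  then obtain c where c: "c > 0" "\<And>w. c * norm w \<le> norm (\<phi> w)"
    using linear_inj_bounded_below_pos[OF lin] by (metis mult.commute)
  obtain K where K: "\<And>x. x \<in> X \<Longrightarrow> norm x \<le> K" using assms by (auto simp: bounded_iff)
  define N where "N = \<lceil>K / c\<rceil>"
  have "{w. lattice_point w \<in> X} \<subseteq> (\<lambda>(a, x). (x, a - p * x)) ` ({- N..N} \<times> {- N..N})"
  proof
    fix w assume w: "w \<in> {w. lattice_point w \<in> X}"
    obtain x y where xy: "w = (x, y)" by (cases w)
    define a where "a = y + p * x"
    have "\<phi> (real_of_int a, real_of_int x) \<in> X" using w by (simp add: \<phi>_def xy lattice_point_def a_def)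
    then have "c * norm (real_of_int a, real_of_int x) \<le> K" using c(2) K order_trans by blast
    then have le: "norm (real_of_int a, real_of_int x) \<le> K / c" using c(1) by (simp add: field_simps)
    have "\<bar>real_of_int a\<bar> \<le> K / c" "\<bar>real_of_int x\<bar> \<le> K / c"
      using norm_fst_le[of "real_of_int a" "real_of_int x"] norm_snd_le[of "real_of_int x" "real_of_int a"] le by auto
    then have "\<bar>a\<bar> \<le> N" "\<bar>x\<bar> \<le> N" unfolding N_def by linarith+
    then show "w \<in> (\<lambda>(a, x). (x, a - p * x)) ` ({- N..N} \<times> {- N..N})"
      by (intro image_eqI[of _ _ "(a, x)"]) (auto simp: xy a_def)
  qed
  then show ?thesis by (rule finite_subset) auto
qed

definition digits :: "int set \<Rightarrow> 'a set" where
  "digits E = (\<lambda>d. real_of_int d *\<^sub>R v) ` E"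

lemma digits_differences:
  "{a - b | a b. a \<in> digits E \<and> b \<in> digits E} = digits {d - e | d e. d \<in> E \<and> e \<in> E}"
proof (intro equalityI subsetI)
  fix x assume "x \<in> {a - b | a b. a \<in> digits E \<and> b \<in> digits E}"
  then obtain d e where de: "d \<in> E" "e \<in> E" "x = real_of_int d *\<^sub>R v - real_of_int e *\<^sub>R v"
    by (auto simp: digits_def)
  then have "x = real_of_int (d - e) *\<^sub>R v" by (simp add: scaleR_diff_left)
  then show "x \<in> digits {d - e | d e. d \<in> E \<and> e \<in> E}"
    unfolding digits_def using de(1,2) by blast
next
  fix x assume "x \<in> digits {d - e | d e. d \<in> E \<and> e \<in> E}"
  then obtain d e where de: "d \<in> E" "e \<in> E" "x = real_of_int (d - e) *\<^sub>R v"
    by (auto simp: digits_def)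
  then have "x = real_of_int d *\<^sub>R v - real_of_int e *\<^sub>R v" by (simp add: scaleR_diff_left)
  then show "x \<in> {a - b | a b. a \<in> digits E \<and> b \<in> digits E}"
    unfolding digits_def using de(1,2) by blast
qed

lemma digit_related_digits_iff:
  assumes "finite E" "d \<in> E" "e \<in> E"
  shows "digit_related (digits E) (real_of_int d *\<^sub>R v) (real_of_int e *\<^sub>R v) \<longleftrightarrow>
    real_of_int (d - e) *\<^sub>R v \<in> attractor (digits {d - e | d e. d \<in> E \<and> e \<in> E})"
proof -
  have "finite (digits E)" "digits E \<noteq> {}" using assms by (auto simp: digits_def)
  from attractor_differences[OF this]
  have "attractor (digits {d - e | d e. d \<in> E \<and> e \<in> E}) =
      {s - t | s t. s \<in> attractor (digits E) \<and> t \<in> attractor (digits E)}"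
    by (simp only: digits_differences)
  moreover have "real_of_int d *\<^sub>R v \<in> digits E" "real_of_int e *\<^sub>R v \<in> digits E"
    using assms by (auto simp: digits_def)
  ultimately show ?thesis unfolding digit_related_def by (auto simp: scaleR_diff_left)
qed

text \<open>All lattice points of the attractor are taken as states. A digit \<delta> used in a
  continuation reappears as the residual -\<delta> of the recurrence.\<close>

lemma sustained_of_attractor:
  assumes "finite \<Delta>" "\<And>\<delta>. \<delta> \<in> \<Delta> \<Longrightarrow> \<bar>\<delta>\<bar> \<le> R" "real_of_int l *\<^sub>R v \<in> attractor (digits \<Delta>)"
  shows "\<exists>S. sustained p q R S \<and> (0, l) \<in> S"
proof -
  let ?S = "{w. lattice_point w \<in> attractor (digits \<Delta>)}"
  have "bounded (attractor (digits \<Delta>))"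
    using assms(1) by (intro bounded_attractor finite_imp_bounded) (simp add: digits_def)
  then have fin: "finite ?S" by (rule finite_lattice_points)
  have "\<exists>z. (y, z) \<in> ?S \<and> \<bar>z + p * y + q * x\<bar> \<le> R" if "(x, y) \<in> ?S" for x y
  proof -
    have "lattice_point (x, y) \<in> attractor (digits \<Delta>)" using that by simp
    then obtain \<delta> where \<delta>: "\<delta> \<in> \<Delta>" "L (lattice_point (x, y)) - real_of_int \<delta> *\<^sub>R v \<in> attractor (digits \<Delta>)"
      using attractor_step by (auto simp: digits_def)
    then have "lattice_point (y, - \<delta> - p * y - q * x) \<in> attractor (digits \<Delta>)"
      unfolding L_lattice_point by simp
    then show ?thesis using assms(2)[OF \<delta>(1)] by (intro exI[of _ "- \<delta> - p * y - q * x"]) auto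
  qed
  then have "sustained p q R ?S" using fin unfolding sustained_def by blast
  moreover have "(0, l) \<in> ?S" using assms(3) by (simp add: lattice_point_def)
  ultimately show ?thesis by blast
qed

text \<open>The lattice points of the states form a witness set. That the whole interval [-R, R]
  consists of digits guarantees that every residual allowed by the bound is realised.\<close>

lemma attractor_of_sustained:
  assumes "{- R..R} \<subseteq> \<Delta>" "sustained p q R S" "(0, l) \<in> S"
  shows "real_of_int l *\<^sub>R v \<in> attractor (digits \<Delta>)"
proof -
  have "lattice_point ` S \<subseteq> attractor (digits \<Delta>)"
  proof (rule subset_attractor)
    show "bounded (lattice_point ` S)"
      using assms(2) by (intro finite_imp_bounded) (simp add: sustained_def)
    fix u assume "u \<in> lattice_point ` S"
    then obtain x y where xy: "(x, y) \<in> S" "u = lattice_point (x, y)" by auto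
    then obtain z where z: "(y, z) \<in> S" "\<bar>z + p * y + q * x\<bar> \<le> R"
      using assms(2) unfolding sustained_def by blast
    define \<delta> where "\<delta> = - (z + p * y + q * x)"
    have "\<delta> \<in> {- R..R}" using z(2) unfolding \<delta>_def atLeastAtMost_iff by linarith
    then have "\<delta> \<in> \<Delta>" using assms(1) by blast
    moreover have "L u - real_of_int \<delta> *\<^sub>R v = lattice_point (y, z)"
      unfolding xy(2) L_lattice_point by (simp add: \<delta>_def)
    ultimately show "\<exists>d\<in>digits \<Delta>. L u - d \<in> lattice_point ` S"
      using z(1) unfolding digits_def by auto
  qed
  moreover have "lattice_point (0, l) = real_of_int l *\<^sub>R v" by (simp add: lattice_point_def)
  ultimately show ?thesis using assms(3) by (metis image_subset_iff)
qed

section \<open>The digit set with a gap\<close>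

context
  fixes m :: int
  assumes q_ge_3: "3 \<le> \<bar>q\<bar>" and m_nonneg: "0 \<le> m"
    and coeff_pos: "0 < q \<Longrightarrow> \<bar>p\<bar> \<le> q" and coeff_neg: "q < 0 \<Longrightarrow> \<bar>p\<bar> \<le> - q - 2"
begin

lemma not_connected_gap_digits:
  assumes "\<not> (m = 0 \<and> exceptional p q)"
  shows "\<not> connected (attractor (digits ({0..\<bar>q\<bar> - 2} \<union> {\<bar>q\<bar> + m})))"
proof -
  let ?E = "{0..\<bar>q\<bar> - 2} \<union> {\<bar>q\<bar> + m}"
  let ?D = "{d - e | d e. d \<in> ?E \<and> e \<in> ?E}"
  have finD: "finite ?D"
    by (rule finite_subset[of _ "(\<lambda>(d, e). d - e) ` (?E \<times> ?E)"]) auto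
  have D_le: "\<bar>\<delta>\<bar> \<le> \<bar>q\<bar> + m" if "\<delta> \<in> ?D" for \<delta> using that m_nonneg by auto
  show ?thesis
  proof (rule not_connected_attractor)
    show "finite (digits ?E)" by (simp add: digits_def)
    show "digits ?E = digits {0..\<bar>q\<bar> - 2} \<union> digits {\<bar>q\<bar> + m}" by (auto simp: digits_def)
    show "digits {0..\<bar>q\<bar> - 2} \<noteq> {}" "digits {\<bar>q\<bar> + m} \<noteq> {}" using q_ge_3 by (auto simp: digits_def)
    fix a b assume "a \<in> digits {0..\<bar>q\<bar> - 2}" "b \<in> digits {\<bar>q\<bar> + m}"
    then obtain d where d: "0 \<le> d" "d \<le> \<bar>q\<bar> - 2" and a: "a = real_of_int d *\<^sub>R v"
      and b: "b = real_of_int (\<bar>q\<bar> + m) *\<^sub>R v" by (auto simp: digits_def)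
    show "\<not> digit_related (digits ?E) a b"
    proof
      assume "digit_related (digits ?E) a b"
      \<comment> \<open>The order is swapped to make the difference |q| + m - d positive; it is at
        least m + 2 because d <= |q| - 2.\<close>
      then have "digit_related (digits ?E) b a" by (rule digit_related_sym)
      then have "real_of_int (\<bar>q\<bar> + m - d) *\<^sub>R v \<in> attractor (digits ?D)"
        unfolding a b using d by (subst (asm) digit_related_digits_iff) auto
      then obtain S where "sustained p q (\<bar>q\<bar> + m) S" "(0, \<bar>q\<bar> + m - d) \<in> S"
        using sustained_of_attractor[OF finD D_le] by blast
      then show False
        using exceptional_of_sustained[of p q m S "\<bar>q\<bar> + m - d"] d m_nonneg q_ge_3 coeff_pos coeff_neg assms
        by auto
    qed
  qed
qed

lemma connected_exceptional_digits:
  assumes "m = 0" "exceptional p q"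
  shows "connected (attractor (digits ({0..\<bar>q\<bar> - 2} \<union> {\<bar>q\<bar> + m})))"
proof -
  let ?E = "{0..\<bar>q\<bar> - 2} \<union> {\<bar>q\<bar> + m}"
  let ?D = "{d - e | d e. d \<in> ?E \<and> e \<in> ?E}"
  let ?R = "digit_related (digits ?E)"
  have D: "{- \<bar>q\<bar>..\<bar>q\<bar>} \<subseteq> ?D"
  proof
    fix \<delta> assume \<delta>: "\<delta> \<in> {- \<bar>q\<bar>..\<bar>q\<bar>}"
    \<comment> \<open>Since |q| - 1 is not a digit, the differences 1 and -1 are taken between the
      digits 0 and 1, both present as |q| >= 3; larger ones involve the last digit |q|.\<close>
    consider "0 \<le> \<delta>" "\<delta> \<le> 1" | "2 \<le> \<delta>" | "\<delta> \<le> - 2" | "- 1 \<le> \<delta>" "\<delta> \<le> 0" by linarith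
    then have "\<exists>d e. \<delta> = d - e \<and> d \<in> ?E \<and> e \<in> ?E"
    proof cases
      case 1
      then show ?thesis using q_ge_3 by (intro exI[of _ \<delta>] exI[of _ 0]) auto
    next
      case 2
      then show ?thesis using \<delta> assms(1) by (intro exI[of _ "\<bar>q\<bar>"] exI[of _ "\<bar>q\<bar> - \<delta>"]) auto
    next
      case 3
      then show ?thesis using \<delta> assms(1) by (intro exI[of _ "\<bar>q\<bar> + \<delta>"] exI[of _ "\<bar>q\<bar>"]) auto
    next
      case 4
      then show ?thesis using q_ge_3 by (intro exI[of _ 0] exI[of _ "- \<delta>"]) auto
    qed
    then show "\<delta> \<in> ?D" by blast
  qed
  have rel: "?R (real_of_int (d + l) *\<^sub>R v) (real_of_int d *\<^sub>R v)"
    if "l = 1 \<or> l = 2" "d \<in> ?E" "d + l \<in> ?E" for d l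
  proof -
    obtain S where "sustained p q \<bar>q\<bar> S" "(0, l) \<in> S"
      using sustained_of_exceptional[OF assms(2) q_ge_3 \<open>l = 1 \<or> l = 2\<close>] by blast
    then have "real_of_int l *\<^sub>R v \<in> attractor (digits ?D)"
      using attractor_of_sustained[OF D] by blast
    moreover have "finite ?E" by simp
    ultimately show ?thesis using that by (subst digit_related_digits_iff) auto
  qed
  have up: "?R\<^sup>*\<^sup>* (real_of_int d *\<^sub>R v) 0 \<and> ?R\<^sup>*\<^sup>* 0 (real_of_int d *\<^sub>R v)" if "d \<in> {0..\<bar>q\<bar> - 2}" for d
  proof -
    have "0 \<le> d" using that by simp
    then show ?thesis using that
    proof (induction d rule: int_ge_induct)
      case base
      then show ?case by simp
    next
      case (step d)
      then have "?R (real_of_int (d + 1) *\<^sub>R v) (real_of_int d *\<^sub>R v)" by (intro rel) auto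
      moreover from this have "?R (real_of_int d *\<^sub>R v) (real_of_int (d + 1) *\<^sub>R v)" by (rule digit_related_sym)
      moreover have "?R\<^sup>*\<^sup>* (real_of_int d *\<^sub>R v) 0" "?R\<^sup>*\<^sup>* 0 (real_of_int d *\<^sub>R v)" using step by auto
      ultimately show ?case by (meson converse_rtranclp_into_rtranclp rtranclp.rtrancl_into_rtrancl)
    qed
  qed
  have "?R\<^sup>*\<^sup>* (real_of_int d *\<^sub>R v) 0 \<and> ?R\<^sup>*\<^sup>* 0 (real_of_int d *\<^sub>R v)" if "d \<in> ?E" for d
  proof (cases "d \<in> {0..\<bar>q\<bar> - 2}")
    case False
    \<comment> \<open>Only the last digit lies beyond the gap, and it is reached by a single step of
      length 2.\<close>
    then have d: "d = (\<bar>q\<bar> - 2) + 2" using that assms(1) by auto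
    have "?R (real_of_int d *\<^sub>R v) (real_of_int (\<bar>q\<bar> - 2) *\<^sub>R v)"
      unfolding d using q_ge_3 assms(1) by (intro rel) auto
    moreover from this have "?R (real_of_int (\<bar>q\<bar> - 2) *\<^sub>R v) (real_of_int d *\<^sub>R v)" by (rule digit_related_sym)
    moreover have "?R\<^sup>*\<^sup>* (real_of_int (\<bar>q\<bar> - 2) *\<^sub>R v) 0 \<and> ?R\<^sup>*\<^sup>* 0 (real_of_int (\<bar>q\<bar> - 2) *\<^sub>R v)"
      using q_ge_3 by (intro up) auto
    ultimately show ?thesis by (meson converse_rtranclp_into_rtranclp rtranclp.rtrancl_into_rtrancl)
  qed (rule up)
  then have to_0: "?R\<^sup>*\<^sup>* a 0 \<and> ?R\<^sup>*\<^sup>* 0 a" if "a \<in> digits ?E" for a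
    using that unfolding digits_def by blast
  show ?thesis
  proof (rule connected_attractor)
    show "finite (digits ?E)" by (simp add: digits_def)
    show "?R\<^sup>*\<^sup>* a b" if "a \<in> digits ?E" "b \<in> digits ?E" for a b
      using to_0[OF that(1)] to_0[OF that(2)] by (meson rtranclp_trans)
  qed
qed

end

end

section \<open>Identification of the self-affine set with the attractor\<close>

lemma (in expanding_map) the_attractor:
  assumes "finite D" "D \<noteq> {}"
  shows "(THE T. T \<noteq> {} \<and> compact T \<and> L ` T = T + D) = attractor D"
proof (rule the_equality)
  show "attractor D \<noteq> {} \<and> compact (attractor D) \<and> L ` attractor D = attractor D + D"
    by (intro conjI attractor_nonempty compact_attractor attractor_eq assms)
  show "T = attractor D" if "T \<noteq> {} \<and> compact T \<and> L ` T = T + D" for T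
    using that assms(1) by (intro attractor_unique) auto
qed

theorem theorem1p2:
  fixes A :: "int ^ 2 ^ 2" and v :: "int ^ 2" and p q m :: int
    and D T :: "(real ^ 2) set"
  assumes "expanding (real_mat A)"
    and "charpoly A = [:q, p, 1:]"
    and "\<bar>q\<bar> \<ge> 3"
    and "m \<ge> 0"
    and "independent {real_vec v, real_vec (A *v v)}"
    and "D = digit_multiples ({0..\<bar>q\<bar> - 2} \<union> {\<bar>q\<bar> + m}) v"
    and "T = self_affine_set (real_mat A) D"
  shows "(m \<ge> 1 \<longrightarrow> \<not> connected T) \<and>
    (m = 0 \<longrightarrow> (connected T \<longleftrightarrow>
      (p, q) \<in> {(p, q). 2 * \<bar>p\<bar> = \<bar>q + 2\<bar>} \<union>
        {(1, -3), (-1, -3), (2, 3), (-2, 3), (3, 3), (-3, 3), (4, 4), (-4, 4)}))"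
proof -
  have "invertible (real_mat A)"
    using det_real_mat[OF assms(2)] assms(3) by (auto simp: invertible_det_nz)
  then obtain B where "real_mat A ** B = mat 1" "B ** real_mat A = mat 1"
    unfolding invertible_def by blast
  then have inv: "real_mat A *v (B *v x) = x" "B *v (real_mat A *v x) = x" for x
    by (simp_all add: matrix_vector_mul_assoc)
  have Lv: "real_vec (A *v v) = real_mat A *v real_vec v"
    by (simp add: vec_eq_iff real_vec_def real_mat_def map_matrix_def matrix_vector_mult_def)
  have indep: "a = 0 \<and> b = 0"
    if "a *\<^sub>R real_vec v + b *\<^sub>R (real_mat A *v real_vec v) = 0" for a b
  proof -
    let ?v = "real_vec v" and ?w = "real_mat A *v real_vec v"
    have v0: "?v \<noteq> 0" using assms(5) dependent_zero by (metis insertI1)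
    \<comment> \<open>Independence of a set says nothing about two coinciding vectors, as the set
      would then be a singleton. Coincidence would make 1 an eigenvalue, against expansion.\<close>
    have "?w \<noteq> ?v"
    proof
      assume eq: "?w = ?v"
      have "real_of_int (1 + p + q) *\<^sub>R ?v = 0"
        using cayley_hamilton_2[OF assms(2), of ?v] by (simp add: eq algebra_simps)
      then have "1 * 1 + real_of_int p * 1 + real_of_int q = 0" using v0 by simp
      from real_root_gt_1[OF assms(1,2) this] show False by simp
    qed
    then have "\<not> dependent {?v, ?w}" using assms(5) Lv by simp
    then show ?thesis
      using independentD[of "{?v, ?w}" "{?v, ?w}" "\<lambda>x. if x = ?v then a else b" ?v]
        independentD[of "{?v, ?w}" "{?v, ?w}" "\<lambda>x. if x = ?v then a else b" ?w] \<open>?w \<noteq> ?v\<close> that by simp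
  qed
  interpret cyclic_expanding_map "(*v) (real_mat A)" "(*v) B" "real_vec v" p q
  proof (intro cyclic_expanding_map.intro expanding_map.intro cyclic_expanding_map_axioms.intro)
    show "(\<lambda>n. ((*v) B ^^ n) x) \<longlonglongrightarrow> 0" for x
      by (rule expanding_inverse_iterates_tendsto_0[OF assms(1,2)]) (rule inv)
    show "linear ((*v) (real_mat A))" "linear ((*v) B)" by simp_all
    show "a = 0 \<and> b = 0" if "a *\<^sub>R real_vec v + b *\<^sub>R (real_mat A *v real_vec v) = 0" for a b
      using that by (rule indep)
  qed (fact inv cayley_hamilton_2[OF assms(2)])+
  have D: "D = digits ({0..\<bar>q\<bar> - 2} \<union> {\<bar>q\<bar> + m})"
    using assms(6) by (simp add: digit_multiples_def digits_def)
  have "finite D" "D \<noteq> {}" unfolding D by (auto simp: digits_def)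
  then have T: "T = attractor D" using assms(7) the_attractor by (simp add: self_affine_set_def)
  note bounds = expanding_imp_linear_coeff_bound[OF assms(1,2)]
  have iff: "connected T \<longleftrightarrow> m = 0 \<and> exceptional p q"
  proof
    show "m = 0 \<and> exceptional p q" if "connected T"
      using not_connected_gap_digits[OF assms(3,4) bounds] that unfolding T D by blast
    show "connected T" if "m = 0 \<and> exceptional p q"
      using connected_exceptional_digits[OF assms(3,4) bounds] that unfolding T D by blast
  qed
  show ?thesis
  proof (intro conjI impI)
    show "\<not> connected T" if "m \<ge> 1" using that iff by simp
    assume "m = 0"
    then have "connected T \<longleftrightarrow> exceptional p q" using iff by simp
    also have "\<dots> \<longleftrightarrow> (p, q) \<in> {(p, q). 2 * \<bar>p\<bar> = \<bar>q + 2\<bar>} \<union>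
        {(1, -3), (-1, -3), (2, 3), (-2, 3), (3, 3), (-3, 3), (4, 4), (-4, 4)}"
      unfolding exceptional_def Un_iff mem_Collect_eq prod.case ..
    finally show "connected T \<longleftrightarrow> (p, q) \<in> {(p, q). 2 * \<bar>p\<bar> = \<bar>q + 2\<bar>} \<union>
        {(1, -3), (-1, -3), (2, 3), (-2, 3), (3, 3), (-3, 3), (4, 4), (-4, 4)}" .
  qed
qed

end
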